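(* Let $z:V\to\mathbb{C}$ be a realization of a simply connected triangular mesh and $q:E_{int}\to i\mathbb{R}$ a discrete holomorphic quadratic differential on $z$. Then there exists $f:F\to\mathbb{R}^3$ such that for every oriented interior edge $e_{ij}$ $$df(e^*_{ij})=\operatorname{Re}\left(\frac{q_{ij}}{i(z_j-z_i)}\begin{pmatrix}1-z_iz_j\\ i(1+z_iz_j)\\ z_i+z_j\end{pmatrix}\right).\qquad( * )$$ Moreover, $f$ is a discrete minimal surface with Gauss map $$n=\frac{1}{|z|^2+1}\begin{pmatrix}2\operatorname{Re}z\\2\operatorname{Im}z\\|z|^2-1\end{pmatrix}:V\to\mathbb{S}^2.$$ Conversely, locally every discrete minimal surface can be written in this form: if $z:V\to\mathbb{C}$ is a realization of a simply connected triangular mesh, $n:V\to\mathbb{S}^2$ is given by $$n=\frac{1}{|z|^2+1}\begin{pmatrix}2\operatorname{Re}z\\2\operatorname{Im}z\\|z|^2-1\end{pmatrix},$$ and $f:F\to\mathbb{R}^3$ is a discrete minimal surface with Gauss map $n$, then there is a discrete holomorphic quadratic differential $q:E_{int}\to i\mathbb{R}$ on $z$ such that $( * )$ holds for every oriented interior edge.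
   Context: A triangular mesh is an oriented simplicial complex whose underlying topological space is a connected 2-manifold (possibly with boundary); $V,E,F$ are its sets of vertices, edges and triangles, $V_{int}$, $E_{int}$ its sets of interior vertices and interior edges. A realization is a map $z:V\to\mathbb{C}$ such that for each triangle $\{ijk\}\in F$ the points $z_i,z_j,z_k$ are not collinear. For an oriented interior edge $e_{ij}$ from $i$ to $j$, $\{ijk\}$ denotes its left face and $\{jil\}$ its right face; for $f$ defined on $F$, $df(e^*_{ij}):=f_{ijk}-f_{jil}$. A function $q:E_{int}\to i\mathbb{R}$ (with $q_{ij}=q_{ji}$) is a discrete holomorphic quadratic differential on $z$ if for every interior vertex $i$: $\sum_j q_{ij}=0$ and $\sum_j q_{ij}/(z_j-z_i)=0$ (sums over all neighbours $j$ of $i$). Let $n:V\to\mathbb{S}^2\subset\mathbb{R}^3$ be a realization of a triangular mesh on the unit sphere. A map $f:F\to\mathbb{R}^3$ is a discrete minimal surface with Gauss map $n$ if for all oriented interior edges $e_{ij}$ one has $(n_j-n_i)\times(f_{ijk}-f_{jil})=0$. The letter $i$ also denotes the imaginary unit when used as a factor. *)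

theory Defs
  imports "HOL-Analysis.Analysis"
begin

section \<open>Abstract simplicial complexes of dimension two and their underlying spaces\<close>

definition abstract_simplicial_complex :: "'v set set \<Rightarrow> bool" where
  "abstract_simplicial_complex K \<longleftrightarrow>
     (\<forall>\<sigma>\<in>K. finite \<sigma> \<and> \<sigma> \<noteq> {}) \<and>
     (\<forall>\<sigma>\<in>K. \<forall>\<tau>. \<tau> \<subseteq> \<sigma> \<and> \<tau> \<noteq> {} \<longrightarrow> \<tau> \<in> K)"

definition vertices :: "'v set set \<Rightarrow> 'v set" where
  "vertices K = \<Union>K"

definition edges :: "'v set set \<Rightarrow> 'v set set" where
  "edges K = {\<sigma> \<in> K. card \<sigma> = 2}"

definition triangles :: "'v set set \<Rightarrow> 'v set set" where
  "triangles K = {\<sigma> \<in> K. card \<sigma> = 3}"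

text \<open>Points of the underlying space are given by their barycentric coordinates. As \<open>\<sigma>\<close> is
  finite, the product topology on functions induces on \<open>closed_simplex \<sigma>\<close> the usual
  Euclidean topology.\<close>

definition closed_simplex :: "'v set \<Rightarrow> ('v \<Rightarrow> real) set" where
  "closed_simplex \<sigma> = {\<alpha>. (\<forall>v. 0 \<le> \<alpha> v) \<and> (\<forall>v. v \<notin> \<sigma> \<longrightarrow> \<alpha> v = 0) \<and> sum \<alpha> \<sigma> = 1}"

text \<open>The underlying space carries the coherent (weak) topology: a set is open iff its trace on
  every closed simplex is relatively open.\<close>

definition underlying_space :: "'v set set \<Rightarrow> ('v \<Rightarrow> real) topology" where
  "underlying_space K = topology (\<lambda>U. U \<subseteq> (\<Union>\<sigma>\<in>K. closed_simplex \<sigma>) \<and>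
     (\<forall>\<sigma>\<in>K. openin (top_of_set (closed_simplex \<sigma>)) (U \<inter> closed_simplex \<sigma>)))"

lemma openin_underlying_space:
  "openin (underlying_space K) U \<longleftrightarrow> U \<subseteq> (\<Union>\<sigma>\<in>K. closed_simplex \<sigma>) \<and>
     (\<forall>\<sigma>\<in>K. openin (top_of_set (closed_simplex \<sigma>)) (U \<inter> closed_simplex \<sigma>))"
proof -
  have "istopology (\<lambda>U. U \<subseteq> (\<Union>\<sigma>\<in>K. closed_simplex \<sigma>) \<and>
     (\<forall>\<sigma>\<in>K. openin (top_of_set (closed_simplex \<sigma>)) (U \<inter> closed_simplex \<sigma>)))"
    unfolding istopology_def
  proof (intro conjI allI impI ballI)
    fix S T \<sigma>
    assume *: "S \<subseteq> (\<Union>\<sigma>\<in>K. closed_simplex \<sigma>) \<and>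
        (\<forall>\<sigma>\<in>K. openin (top_of_set (closed_simplex \<sigma>)) (S \<inter> closed_simplex \<sigma>))"
      "T \<subseteq> (\<Union>\<sigma>\<in>K. closed_simplex \<sigma>) \<and>
        (\<forall>\<sigma>\<in>K. openin (top_of_set (closed_simplex \<sigma>)) (T \<inter> closed_simplex \<sigma>))"
    then show "S \<inter> T \<subseteq> (\<Union>\<sigma>\<in>K. closed_simplex \<sigma>)" by blast
    assume "\<sigma> \<in> K"
    with * have "openin (top_of_set (closed_simplex \<sigma>)) (S \<inter> closed_simplex \<sigma>)"
      and "openin (top_of_set (closed_simplex \<sigma>)) (T \<inter> closed_simplex \<sigma>)"
      by simp_all
    from openin_Int [OF this]
    show "openin (top_of_set (closed_simplex \<sigma>)) (S \<inter> T \<inter> closed_simplex \<sigma>)"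
      by (simp add: Int_assoc Int_left_commute)
  next
    fix \<C> \<sigma>
    assume *: "\<forall>U\<in>\<C>. U \<subseteq> (\<Union>\<sigma>\<in>K. closed_simplex \<sigma>) \<and>
        (\<forall>\<sigma>\<in>K. openin (top_of_set (closed_simplex \<sigma>)) (U \<inter> closed_simplex \<sigma>))"
    then show "\<Union>\<C> \<subseteq> (\<Union>\<sigma>\<in>K. closed_simplex \<sigma>)" by blast
    assume "\<sigma> \<in> K"
    then have "openin (top_of_set (closed_simplex \<sigma>)) (\<Union>U\<in>\<C>. U \<inter> closed_simplex \<sigma>)"
      using * by (intro openin_Union ballI) (elim imageE, simp)
    then show "openin (top_of_set (closed_simplex \<sigma>)) (\<Union>\<C> \<inter> closed_simplex \<sigma>)"
      by (simp only: Int_Union2)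
  qed
  then show ?thesis
    by (simp add: underlying_space_def)
qed

text \<open>A 2-manifold, possibly with boundary: the local model is the closed upper half plane, whose
  relatively open subsets include open discs.\<close>

definition surface_with_boundary :: "'a topology \<Rightarrow> bool" where
  "surface_with_boundary X \<longleftrightarrow>
     Hausdorff_space X \<and> second_countable X \<and>
     (\<forall>x\<in>topspace X. \<exists>U S. openin X U \<and> x \<in> U \<and>
        openin (top_of_set {w::complex. 0 \<le> Im w}) S \<and>
        subtopology X U homeomorphic_space top_of_set S)"

text \<open>The library's \<open>simply_connected\<close> is for subsets of a type-class topology; this is the same
  notion for an abstract topology.\<close>

definition simply_connected_space :: "'a topology \<Rightarrow> bool" where
  "simply_connected_space X \<longleftrightarrow>
     path_connected_space X \<and>
     (\<forall>p. pathin X p \<and> p 0 = p 1 \<longrightarrow>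
        (\<exists>c. homotopic_with (\<lambda>r. r 0 = r 1) (top_of_set {0..1::real}) X p (\<lambda>_. c)))"


section \<open>Triangular meshes\<close>

text \<open>\<open>T i j k\<close> says that \<open>(i, j, k)\<close> is a positively oriented enumeration of the triangle
  \<open>{i, j, k}\<close>. By the last clause, distinct triangles with a common edge induce opposite
  orientations on it.\<close>

definition coherent_orientation :: "'v set set \<Rightarrow> ('v \<Rightarrow> 'v \<Rightarrow> 'v \<Rightarrow> bool) \<Rightarrow> bool" where
  "coherent_orientation K T \<longleftrightarrow>
     (\<forall>i j k. T i j k \<longrightarrow> {i, j, k} \<in> triangles K) \<and>
     (\<forall>i j k. T i j k \<longrightarrow> T j k i) \<and>
     (\<forall>i j k. {i, j, k} \<in> triangles K \<longrightarrow> (T i j k \<longleftrightarrow> \<not> T j i k)) \<and>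
     (\<forall>i j k l. T i j k \<and> T i j l \<longrightarrow> k = l)"

text \<open>The second clause makes the complex two-dimensional, and holds automatically when the
  underlying space is a 2-manifold. Meshes may be infinite.\<close>

definition triangular_mesh :: "'v set set \<Rightarrow> ('v \<Rightarrow> 'v \<Rightarrow> 'v \<Rightarrow> bool) \<Rightarrow> bool" where
  "triangular_mesh K T \<longleftrightarrow>
     abstract_simplicial_complex K \<and>
     (\<forall>\<sigma>\<in>K. \<exists>\<tau>\<in>triangles K. \<sigma> \<subseteq> \<tau>) \<and>
     coherent_orientation K T \<and>
     connected_space (underlying_space K) \<and>
     surface_with_boundary (underlying_space K)"

text \<open>In a surface every edge lies in one triangle (boundary edge) or in two (interior edge).
  Interior vertices are the vertices that lie on no boundary edge.\<close>

definition interior_edges :: "'v set set \<Rightarrow> 'v set set" where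
  "interior_edges K = {e \<in> edges K. card {t \<in> triangles K. e \<subseteq> t} = 2}"

definition interior_vertices :: "'v set set \<Rightarrow> 'v set" where
  "interior_vertices K = {v \<in> vertices K. \<forall>e\<in>edges K. v \<in> e \<longrightarrow> e \<in> interior_edges K}"

definition neighbours :: "'v set set \<Rightarrow> 'v \<Rightarrow> 'v set" where
  "neighbours K i = {j. {i, j} \<in> edges K}"

text \<open>The following two are meaningful only when \<open>{i, j}\<close> is an interior edge.\<close>

definition left_face :: "('v \<Rightarrow> 'v \<Rightarrow> 'v \<Rightarrow> bool) \<Rightarrow> 'v \<Rightarrow> 'v \<Rightarrow> 'v set" where
  "left_face T i j = {i, j, THE k. T i j k}"

definition right_face :: "('v \<Rightarrow> 'v \<Rightarrow> 'v \<Rightarrow> bool) \<Rightarrow> 'v \<Rightarrow> 'v \<Rightarrow> 'v set" where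
  "right_face T i j = {j, i, THE l. T j i l}"

definition dual_diff ::
    "('v \<Rightarrow> 'v \<Rightarrow> 'v \<Rightarrow> bool) \<Rightarrow> ('v set \<Rightarrow> 'b::ab_group_add) \<Rightarrow> 'v \<Rightarrow> 'v \<Rightarrow> 'b" where
  "dual_diff T f i j = f (left_face T i j) - f (right_face T i j)"


section \<open>Realizations, quadratic differentials and minimal surfaces\<close>

text \<open>Functions on vertices, edges and triangles are total; only their values on \<open>vertices K\<close>,
  \<open>interior_edges K\<close> and \<open>triangles K\<close>, respectively, are constrained. Note that a triangle
  on which \<open>z\<close> is not injective has collinear image.\<close>

definition realization :: "'v set set \<Rightarrow> ('v \<Rightarrow> 'b::real_vector) \<Rightarrow> bool" where
  "realization K z \<longleftrightarrow> (\<forall>t\<in>triangles K. \<not> collinear (z ` t))"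

definition holomorphic_quadratic_differential ::
    "'v set set \<Rightarrow> ('v \<Rightarrow> complex) \<Rightarrow> ('v set \<Rightarrow> complex) \<Rightarrow> bool" where
  "holomorphic_quadratic_differential K z q \<longleftrightarrow>
     (\<forall>e\<in>interior_edges K. Re (q e) = 0) \<and>
     (\<forall>i\<in>interior_vertices K.
        (\<Sum>j\<in>neighbours K i. q {i, j}) = 0 \<and>
        (\<Sum>j\<in>neighbours K i. q {i, j} / (z j - z i)) = 0)"

definition spherical_realization :: "'v set set \<Rightarrow> ('v \<Rightarrow> real^3) \<Rightarrow> bool" where
  "spherical_realization K n \<longleftrightarrow> realization K n \<and> n ` vertices K \<subseteq> sphere 0 1"

definition discrete_minimal_surface ::
    "'v set set \<Rightarrow> ('v \<Rightarrow> 'v \<Rightarrow> 'v \<Rightarrow> bool) \<Rightarrow> ('v \<Rightarrow> real^3) \<Rightarrow> ('v set \<Rightarrow> real^3) \<Rightarrow> bool" where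
  "discrete_minimal_surface K T n f \<longleftrightarrow>
     spherical_realization K n \<and>
     (\<forall>i j. {i, j} \<in> interior_edges K \<longrightarrow> cross3 (n j - n i) (dual_diff T f i j) = 0)"

definition inverse_stereographic :: "complex \<Rightarrow> real^3" where
  "inverse_stereographic w =
     (1 / ((cmod w)\<^sup>2 + 1)) *\<^sub>R vector [2 * Re w, 2 * Im w, (cmod w)\<^sup>2 - 1]"

definition Re_vec :: "complex^3 \<Rightarrow> real^3" where
  "Re_vec w = (\<chi> m. Re (w $ m))"

definition weierstrass_representation ::
    "'v set set \<Rightarrow> ('v \<Rightarrow> 'v \<Rightarrow> 'v \<Rightarrow> bool) \<Rightarrow> ('v \<Rightarrow> complex) \<Rightarrow> ('v set \<Rightarrow> complex) \<Rightarrow>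
      ('v set \<Rightarrow> real^3) \<Rightarrow> bool" where
  "weierstrass_representation K T z q f \<longleftrightarrow>
     (\<forall>i j. {i, j} \<in> interior_edges K \<longrightarrow>
        dual_diff T f i j =
          Re_vec ((q {i, j} / (\<i> * (z j - z i))) *s
            vector [1 - z i * z j, \<i> * (1 + z i * z j), z i + z j]))"

end

theory Submission
  imports Defs
begin

text \<open>Up to a real factor, the vector in the Weierstrass formula is the difference of the Gauss map
  along the edge, so minimality means exactly that the dual differences have this form with an
  imaginary \<open>q\<close>, and holomorphicity of \<open>q\<close> at an interior vertex is the vanishing of the sum of the
  dual differences around it. What remains is to integrate a dual one-form that is closed at all
  interior vertices. As a surface has connected vertex links, it has a potential on the triangles
  around each vertex; two such potentials differ by a constant on every common edge. These constants
  form a Cech cocycle for the cover of the underlying space by open stars, and lifting the contraction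
  of loops shows that such a cocycle is a coboundary when the space is simply connected.\<close>

section \<open>The null curve and the stereographic projection\<close>


text \<open>The vector (1 - ab, \<i>(1 + ab), a + b) is the polarization of the classical isotropic
  vector (1 - z^2, \<i>(1 + z^2), 2z). For fixed a it is affine in b, and b = a + (b - a) splits its
  sum around a vertex into the sums of q_ij/(z_j - z_i) and of q_ij. As q is imaginary these are
  three real unknowns, so closing up in R^3 is equivalent to both holomorphicity conditions. The
  obstacle is that simple connectedness speaks of continuous loops in the weak topology, whereas f
  lives on triangles. The Cech form avoids comparing loops with chains of triangles: it uses only
  that open stars are open and path connected and that two of them meet exactly when their vertices
  share a triangle. Connected links matter because at a pinched vertex, whose link consists of
  several cycles, the sum over all neighbours can vanish while the sum over one cycle does not.
  Local finiteness does not enter: a sum over an infinite set is 0 by convention, and only a finite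
  cycle in a link obstructs integration.\<close>

definition null_curve :: "complex \<Rightarrow> complex \<Rightarrow> real^3" where
  "null_curve a b =
     Re_vec ((1 / (b - a)) *s vector [1 - a * b, \<i> * (1 + a * b), a + b])"

text \<open>For imaginary q the factor 1/\<i> of the formula cancels, so the weight of the vector is
  real and can be taken out of the real part.\<close>

lemma Re_vec_eq_null_curve:
  assumes "Re q = 0"
  shows "Re_vec ((q / (\<i> * (b - a))) *s vector [1 - a * b, \<i> * (1 + a * b), a + b]) =
    Im q *\<^sub>R null_curve a b"
proof -
  have "q = \<i> * of_real (Im q)"
    using assms by (simp add: complex_eq_iff)
  then have "q / (\<i> * (b - a)) = of_real (Im q) * (1 / (b - a))"
    by (metis complex_i_not_zero mult_divide_mult_cancel_left times_divide_eq_right mult.right_neutral)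
  then have "Re ((q / (\<i> * (b - a))) * w) = Im q * Re ((1 / (b - a)) * w)" for w
  proof -
    have "Re (of_real r * w') = r * Re w'" for r w' by simp
    then show ?thesis by (metis \<open>q / (\<i> * (b - a)) = of_real (Im q) * (1 / (b - a))\<close> mult.assoc)
  qed
  then show ?thesis
    by (simp add: null_curve_def Re_vec_def vec_eq_iff)
qed

lemma null_curve_commute: "null_curve b a = - null_curve a b"
proof -
  have "1 / (a - b) = - (1 / (b - a))"
    by (metis minus_diff_eq minus_divide_right)
  then show ?thesis
    unfolding null_curve_def Re_vec_def vec_eq_iff by (simp add: mult.commute add.commute)
qed

text \<open>All denominators are cleared, which leaves a polynomial identity in real coordinates: |b
  - a|^2 Re (w / (b - a)) is the Euclidean inner product of w and b - a, and the stereographic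
  denominators cancel against the factor on the right.\<close>

lemma null_curve_stereographic:
  assumes "a \<noteq> b"
  shows "(2 * (cmod (b - a))\<^sup>2) *\<^sub>R null_curve a b =
    ((1 + (cmod a)\<^sup>2) * (1 + (cmod b)\<^sup>2)) *\<^sub>R (inverse_stereographic b - inverse_stereographic a)"
proof -
  have D: "(cmod (b - a))\<^sup>2 \<noteq> 0"
    using assms by simp
  have *: "2 * (cmod (b - a))\<^sup>2 * Re (w / (b - a)) = 2 * (Re w * Re (b - a) + Im w * Im (b - a))" for w
    using D unfolding cmod_power2 Re_divide
    by (metis mult.assoc nonzero_mult_div_cancel_left times_divide_eq_right)
  have pos: "(cmod w)\<^sup>2 + 1 \<noteq> 0" for w
    by (smt (verit) zero_le_power2)
  have **: "(1 + (cmod a)\<^sup>2) * (1 + (cmod b)\<^sup>2) * (r / ((cmod b)\<^sup>2 + 1) - s / ((cmod a)\<^sup>2 + 1)) =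
      (1 + (cmod a)\<^sup>2) * r - (1 + (cmod b)\<^sup>2) * s" for r s
  proof -
    have "p * q * (r / q - s / p) = p * r - q * s" if "p \<noteq> 0" "q \<noteq> 0" for p q :: real
      using that by (auto simp: field_simps)
    from this[OF pos[of a] pos[of b]] show ?thesis by (simp add: add.commute)
  qed
  show ?thesis
    unfolding null_curve_def Re_vec_def vec_eq_iff inverse_stereographic_def forall_3
    by (simp add: * ** del: minus_complex.sel)
      (simp add: cmod_power2, simp add: power2_eq_square algebra_simps)
qed

lemma inverse_stereographic_eq_iff [simp]:
  "inverse_stereographic a = inverse_stereographic b \<longleftrightarrow> a = b"
proof
  assume eq: "inverse_stereographic a = inverse_stereographic b"
  have pos: "(cmod w)\<^sup>2 + 1 > 0" for w
    by (smt (verit) zero_le_power2)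
  define s where "s = (\<lambda>w. 1 / ((cmod w)\<^sup>2 + 1))"
  \<comment> \<open>The third coordinate of the projection is 1 - 2 s, so it determines the scale
    \<open>s\<close>; then the first two coordinates determine the point.\<close>
  have 1: "1 - 2 * s a = 1 - 2 * s b"
    using arg_cong[OF eq, of "\<lambda>x. x $ 3"] pos[of a] pos[of b]
    unfolding s_def inverse_stereographic_def by (simp add: field_simps)
  have "s a * (2 * Re a) = s b * (2 * Re b)" "s a * (2 * Im a) = s b * (2 * Im b)"
    using arg_cong[OF eq, of "\<lambda>x. x $ 1"] arg_cong[OF eq, of "\<lambda>x. x $ 2"]
    unfolding s_def inverse_stereographic_def by simp_all
  moreover have "s b \<noteq> 0" using pos[of b] by (simp add: s_def)
  ultimately show "a = b"
    using 1 by (simp add: complex_eq_iff)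
qed simp

lemma norm_inverse_stereographic: "norm (inverse_stereographic w) = 1"
proof -
  define s where "s = (cmod w)\<^sup>2 + 1"
  have "s \<noteq> 0" unfolding s_def by (smt (verit) zero_le_power2)
  have "(norm (vector [2 * Re w, 2 * Im w, (cmod w)\<^sup>2 - 1] :: real^3))\<^sup>2 = s\<^sup>2"
    unfolding s_def cmod_power2 power2_norm_eq_inner inner_vec_def sum_3
    by (simp add: power2_eq_square algebra_simps)
  then have "(norm (inverse_stereographic w))\<^sup>2 = 1"
    using \<open>s \<noteq> 0\<close> unfolding inverse_stereographic_def s_def[symmetric]
    by (simp add: power_mult_distrib power_divide)
  then show ?thesis
    by (simp add: power2_eq_1_iff) (smt (verit) norm_ge_zero)
qed

text \<open>A line meets the sphere at most twice: for w = c y + (1 - c) x the condition |w| = 1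
  reads 2 c (1 - c) (1 - x . y) = 0, and x . y = 1 would force x = y.\<close>

lemma not_collinear_sphere:
  fixes x y w :: "'a::euclidean_space"
  assumes "norm x = 1" "norm y = 1" "norm w = 1" "x \<noteq> y" "y \<noteq> w" "x \<noteq> w"
  shows "\<not> collinear {x, y, w}"
proof
  assume "collinear {x, y, w}"
  then have "collinear {y, x, w}" by (simp add: insert_commute)
  then obtain c where c: "w = c *\<^sub>R y + (1 - c) *\<^sub>R x"
    using assms by (metis collinear_3_expand insert_commute)
  have "(norm w)\<^sup>2 = c\<^sup>2 * (norm y)\<^sup>2 + (1 - c)\<^sup>2 * (norm x)\<^sup>2 + 2 * c * (1 - c) * (x \<bullet> y)"
    unfolding c power2_norm_eq_inner
    by (simp add: inner_simps inner_commute power2_eq_square algebra_simps)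
  then have "2 * c * (1 - c) * (1 - x \<bullet> y) = 0"
    using assms by (simp add: power2_eq_square algebra_simps)
  moreover have "x \<bullet> y \<noteq> 1"
  proof
    assume "x \<bullet> y = 1"
    then have "(norm (x - y))\<^sup>2 = 0"
      using assms unfolding power2_norm_eq_inner by (simp add: inner_simps inner_commute norm_eq_1)
    then show False using assms by simp
  qed
  ultimately have "c = 0 \<or> c = 1" by simp
  then show False using c assms by auto
qed

text \<open>These are three real linear equations in Re A, Im A and R. The third gives R = -2 Re (z
  A), and substitution in the other two leaves (|z|^2 + 1) Re A = 0 and (|z|^2 + 1) Im A =
  0.\<close>

lemma Weierstrass_data_closed_imp_zero:
  fixes z A :: complex and R :: real
  assumes "Re ((1 - z\<^sup>2) * A - z * R) = 0" "Re (\<i> * (1 + z\<^sup>2) * A + \<i> * z * R) = 0"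
    "Re (2 * z * A + R) = 0"
  shows "A = 0" "R = 0"
proof -
  obtain x y u v where [simp]: "z = Complex x y" "A = Complex u v"
    by (meson complex.exhaust)
  have R: "R = - 2 * (x * u - y * v)"
    using assms(3) by simp
  have pos: "x\<^sup>2 + y\<^sup>2 + 1 \<noteq> 0"
    by (smt (verit) zero_le_power2)
  have "(x\<^sup>2 + y\<^sup>2 + 1) * u = 0" "(x\<^sup>2 + y\<^sup>2 + 1) * v = 0"
    using assms(1,2) unfolding R by (auto simp: power2_eq_square algebra_simps)
  then have "u = 0" "v = 0" using pos by simp_all
  then show "A = 0" "R = 0" using R by (simp_all add: complex_eq_iff)
qed

text \<open>Each entry of the vector has the form p + s (z j - a), with (p, s) equal to (1 - a^2,
  -a), (\<i> (1 + a^2), \<i> a) and (2 a, 1). The weighted sum is then Re (p A + s R), and the three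
  coordinates form the system of \<open>Weierstrass_data_closed_imp_zero\<close>.\<close>

lemma sum_null_curve_eq_0_iff:
  assumes "finite N" "\<And>j. j \<in> N \<Longrightarrow> z j \<noteq> a"
  shows "(\<Sum>j\<in>N. \<rho> j *\<^sub>R null_curve a (z j)) = 0 \<longleftrightarrow>
    (\<Sum>j\<in>N. \<rho> j) = 0 \<and> (\<Sum>j\<in>N. of_real (\<rho> j) / (z j - a)) = 0"
proof -
  define A where "A = (\<Sum>j\<in>N. of_real (\<rho> j) / (z j - a))"
  define R where "R = (\<Sum>j\<in>N. \<rho> j)"
  have *: "\<rho> j * Re ((1 / (z j - a)) * (p + s * (z j - a))) = Re (p * (of_real (\<rho> j) / (z j - a)) + s * of_real (\<rho> j))"
    if "j \<in> N" for p s j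
  proof -
    have "of_real (\<rho> j) * ((1 / (z j - a)) * (p + s * (z j - a))) = p * (of_real (\<rho> j) / (z j - a)) + s * of_real (\<rho> j)"
      using assms(2)[OF that] by (simp add: field_simps)
    moreover have "Re (of_real r * w) = r * Re w" for r w by simp
    ultimately show ?thesis by metis
  qed
  have c: "(\<Sum>j\<in>N. \<rho> j * Re ((1 / (z j - a)) * (p + s * (z j - a)))) = Re (p * A + s * of_real R)" for p s
    using * by (simp add: A_def R_def sum_distrib_left sum.distrib)
  have "(\<Sum>j\<in>N. \<rho> j *\<^sub>R null_curve a (z j)) $ 1 = Re ((1 - a\<^sup>2) * A - a * R)"
    using c[of "1 - a\<^sup>2" "- a"]
    by (simp add: null_curve_def Re_vec_def power2_eq_square algebra_simps)
  moreover have "(\<Sum>j\<in>N. \<rho> j *\<^sub>R null_curve a (z j)) $ 2 = Re (\<i> * (1 + a\<^sup>2) * A + \<i> * a * R)"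
    using c[of "\<i> * (1 + a\<^sup>2)" "\<i> * a"]
    by (simp add: null_curve_def Re_vec_def power2_eq_square algebra_simps add_divide_distrib)
  moreover have "(\<Sum>j\<in>N. \<rho> j *\<^sub>R null_curve a (z j)) $ 3 = Re (2 * a * A + R)"
    using c[of "2 * a" 1]
    by (simp add: null_curve_def Re_vec_def power2_eq_square algebra_simps)
  ultimately show ?thesis
    using Weierstrass_data_closed_imp_zero[of a A R]
    unfolding A_def[symmetric] R_def[symmetric] vec_eq_iff forall_3 by auto
qed


lemma null_curve_proportional:
  assumes "a \<noteq> b"
  obtains s where "s \<noteq> 0" "null_curve a b = s *\<^sub>R (inverse_stereographic b - inverse_stereographic a)"
proof
  let ?d = "2 * (cmod (b - a))\<^sup>2" and ?s = "(1 + (cmod a)\<^sup>2) * (1 + (cmod b)\<^sup>2)"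
  have pos: "1 + (cmod w)\<^sup>2 \<noteq> 0" for w
    by (smt (verit) zero_le_power2)
  show "?s / ?d \<noteq> 0"
    using assms pos by simp
  have "null_curve a b = (1 / ?d) *\<^sub>R (?d *\<^sub>R null_curve a b)"
    using assms by simp
  also have "\<dots> = (?s / ?d) *\<^sub>R (inverse_stereographic b - inverse_stereographic a)"
    unfolding null_curve_stereographic[OF assms] by simp
  finally show "null_curve a b = (?s / ?d) *\<^sub>R (inverse_stereographic b - inverse_stereographic a)" .
qed

lemma cross3_stereographic_eq_0_iff:
  assumes "a \<noteq> b"
  shows "cross3 (inverse_stereographic b - inverse_stereographic a) x = 0 \<longleftrightarrow>
    (\<exists>r. x = r *\<^sub>R null_curve a b)"
proof -
  obtain s where s: "s \<noteq> 0" "null_curve a b = s *\<^sub>R (inverse_stereographic b - inverse_stereographic a)"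
    using null_curve_proportional[OF assms] by metis
  let ?n = "inverse_stereographic b - inverse_stereographic a"
  have "?n \<noteq> 0" using assms by simp
  then have "cross3 ?n x = 0 \<longleftrightarrow> (\<exists>r. x = r *\<^sub>R ?n)"
    unfolding cross_eq_0 collinear_lemma by (metis scaleR_zero_left)
  also have "\<dots> \<longleftrightarrow> (\<exists>r. x = r *\<^sub>R null_curve a b)"
  proof
    assume "\<exists>r. x = r *\<^sub>R ?n"
    then obtain r where "x = r *\<^sub>R ?n" by metis
    then have "x = (r / s) *\<^sub>R null_curve a b" using s by simp
    then show "\<exists>r. x = r *\<^sub>R null_curve a b" ..
  next
    assume "\<exists>r. x = r *\<^sub>R null_curve a b"
    then obtain r where "x = r *\<^sub>R null_curve a b" by metis
    then have "x = (r * s) *\<^sub>R ?n" using s(2) by simp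
    then show "\<exists>r. x = r *\<^sub>R ?n" ..
  qed
  finally show ?thesis .
qed

text \<open>An imaginary \<open>q j\<close> is \<i> times its imaginary part, so \<i> factors out of
  both complex sums and real weights remain. For infinite \<open>N\<close> all sums are 0 and both
  sides hold.\<close>

lemma holomorphic_at_vertex_iff:
  assumes "\<And>j. j \<in> N \<Longrightarrow> z j \<noteq> a" "\<And>j. j \<in> N \<Longrightarrow> Re (q j) = 0"
  shows "(\<Sum>j\<in>N. q j) = 0 \<and> (\<Sum>j\<in>N. q j / (z j - a)) = 0 \<longleftrightarrow>
    (\<Sum>j\<in>N. Im (q j) *\<^sub>R null_curve a (z j)) = 0"
proof (cases "finite N")
  case True
  have q: "q j = \<i> * of_real (Im (q j))" if "j \<in> N" for j
    using assms(2)[OF that] by (simp add: complex_eq_iff)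
  then have "(\<Sum>j\<in>N. q j) = (\<Sum>j\<in>N. \<i> * of_real (Im (q j)))"
    by (rule sum.cong[OF refl])
  then have 1: "(\<Sum>j\<in>N. q j) = \<i> * of_real (\<Sum>j\<in>N. Im (q j))"
    by (simp add: sum_distrib_left)
  have "(\<Sum>j\<in>N. q j / (z j - a)) = (\<Sum>j\<in>N. \<i> * (of_real (Im (q j)) / (z j - a)))"
    using q by (intro sum.cong[OF refl]) (metis times_divide_eq_right)
  then have 2: "(\<Sum>j\<in>N. q j / (z j - a)) = \<i> * (\<Sum>j\<in>N. of_real (Im (q j)) / (z j - a))"
    by (simp add: sum_distrib_left)
  show ?thesis
    unfolding 1 2 using sum_null_curve_eq_0_iff[OF True assms(1), where \<rho> = "\<lambda>j. Im (q j)"]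
    by (simp del: of_real_sum)
qed simp

section \<open>Oriented complexes and local potentials\<close>


text \<open>In the graph of \<nu> every point has one outgoing edge, so a component contains at most
  one cycle, and only that cycle can obstruct the integration of \<open>w\<close>. The potential at
  x is obtained by following the orbit of a base point to a place where it meets the orbit of x, and
  then going back to x.\<close>

lemma ex_coboundary_of_map:
  fixes \<nu> :: "'a \<Rightarrow> 'a" and w :: "'a \<Rightarrow> 'b::ab_group_add"
  assumes cycle: "\<And>x n. \<lbrakk>(\<nu> ^^ n) x = x; inj_on (\<lambda>i. (\<nu> ^^ i) x) {..<n}\<rbrakk> \<Longrightarrow>
      (\<Sum>i<n. w ((\<nu> ^^ i) x)) = 0"
  obtains a where "\<And>x. a (\<nu> x) = a x + w x"
proof -
  define S where "S = (\<lambda>n x. \<Sum>i<n. w ((\<nu> ^^ i) x))"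
  have pow_add: "(\<nu> ^^ (m + n)) x = (\<nu> ^^ n) ((\<nu> ^^ m) x)" for m n x
    by (metis add.commute comp_apply funpow_add)
  have S_add: "S (m + n) x = S m x + S n ((\<nu> ^^ m) x)" for m n x
    by (induction n) (simp_all add: S_def pow_add add.assoc del: funpow.simps)
  have S_cycle: "S n x = 0" if "(\<nu> ^^ n) x = x" for n x
    using that
  proof (induction n rule: less_induct)
    case (less n)
    show ?case
    proof (cases "inj_on (\<lambda>i. (\<nu> ^^ i) x) {..<n}")
      case True
      then show ?thesis using cycle less.prems by (simp add: S_def)
    next
      case False
      then obtain i j where ij: "i < j" "j < n" "(\<nu> ^^ i) x = (\<nu> ^^ j) x"
        unfolding inj_on_def by (metis lessThan_iff linorder_neqE_nat)
      \<comment> \<open>Cutting out the stretch from i to j leaves the shorter period m; since n is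
        a period as well, so is the removed length j - i.\<close>
      define m where "m = i + (n - j)"
      have n: "n = j + (n - j)" "n = m + (j - i)" "m < n" "j - i < n"
        using ij by (simp_all add: m_def)
      have m: "(\<nu> ^^ m) x = x"
        using less.prems ij n(1) pow_add unfolding m_def by metis
      moreover have "(\<nu> ^^ (j - i)) x = x"
        using less.prems n(2) pow_add m by metis
      ultimately have "S m x = 0" "S (j - i) x = 0"
        using less.IH n(3,4) by auto
      then show ?thesis
        using S_add[of m "j - i" x] m n(2) by simp
    qed
  qed
  have S_eq: "S m x = S n x" if "(\<nu> ^^ m) x = (\<nu> ^^ n) x" for m n x
  proof -
    have "S m x = S (m + d) x" if "(\<nu> ^^ m) x = (\<nu> ^^ (m + d)) x" for m d
      using that S_add[of m d x] S_cycle[of d "(\<nu> ^^ m) x"] by (simp add: pow_add)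
    then show ?thesis using that by (metis nat_le_iff_add nat_le_linear)
  qed
  \<comment> \<open>Points are grouped by whether their orbits meet, and \<rho> x is the base point
    of the group of x. The selecting predicates for x and \<nu> x are equivalent, so both get the
    same base point.\<close>
  define \<rho> where "\<rho> = (\<lambda>x. SOME y. \<exists>m n. (\<nu> ^^ m) x = (\<nu> ^^ n) y)"
  have \<rho>: "\<exists>m n. (\<nu> ^^ m) x = (\<nu> ^^ n) (\<rho> x)" for x
    unfolding \<rho>_def by (rule someI[of _ x]) blast
  have \<rho>_step: "\<rho> (\<nu> x) = \<rho> x" for x
  proof -
    have "(\<exists>m n. (\<nu> ^^ m) (\<nu> x) = (\<nu> ^^ n) y) \<longleftrightarrow> (\<exists>m n. (\<nu> ^^ m) x = (\<nu> ^^ n) y)" for y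
      by (metis comp_apply funpow.simps(2) funpow_Suc_right)
    then show ?thesis by (simp add: \<rho>_def)
  qed
  \<comment> \<open>Moving the meeting point of the two orbits further along adds the same stretch
    to both sums.\<close>
  have wd: "S n r - S m x = S n' r - S m' x"
    if "(\<nu> ^^ m) x = (\<nu> ^^ n) r" "(\<nu> ^^ m') x = (\<nu> ^^ n') r" for m n m' n' x r
  proof -
    have *: "S n r - S m x = S n' r - S (m + d) x"
      if "(\<nu> ^^ m) x = (\<nu> ^^ n) r" "(\<nu> ^^ (m + d)) x = (\<nu> ^^ n') r" for m n d n'
    proof -
      have "S n r + S d ((\<nu> ^^ n) r) = S n' r"
        using S_eq[of "n + d" r n'] that by (simp add: pow_add S_add)
      moreover have "S (m + d) x = S m x + S d ((\<nu> ^^ n) r)"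
        using that(1) by (simp add: S_add)
      ultimately show ?thesis by (simp add: algebra_simps)
    qed
    show ?thesis
      using *[of m n "m' - m" n'] *[of m' n' "m - m'" n] that by (cases "m \<le> m'") auto
  qed
  define a where "a = (\<lambda>x. SOME b. \<exists>m n. (\<nu> ^^ m) x = (\<nu> ^^ n) (\<rho> x) \<and> b = S n (\<rho> x) - S m x)"
  have a: "a x = S n (\<rho> x) - S m x" if "(\<nu> ^^ m) x = (\<nu> ^^ n) (\<rho> x)" for x m n
  proof -
    have "\<exists>m n. (\<nu> ^^ m) x = (\<nu> ^^ n) (\<rho> x) \<and> a x = S n (\<rho> x) - S m x"
      unfolding a_def by (rule someI_ex) (use that in blast)
    then show ?thesis using wd that by metis
  qed
  show ?thesis
  proof (rule that)
    fix x
    obtain m n where mn: "(\<nu> ^^ m) (\<nu> x) = (\<nu> ^^ n) (\<rho> x)"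
      using \<rho>[of "\<nu> x"] \<rho>_step by metis
    then have "a (\<nu> x) = S n (\<rho> x) - S m (\<nu> x)"
      using a[of m "\<nu> x" n] \<rho>_step by simp
    moreover have "a x = S n (\<rho> x) - S (1 + m) x"
      using mn by (intro a) (simp add: funpow_swap1)
    ultimately show "a (\<nu> x) = a x + w x"
      using S_add[of 1 m x] by (simp add: S_def)
  qed
qed

section \<open>Combinatorics of oriented triangles around edges and vertices\<close>

locale oriented_complex =
  fixes K :: "'v set set" and T :: "'v \<Rightarrow> 'v \<Rightarrow> 'v \<Rightarrow> bool"
  assumes complex: "abstract_simplicial_complex K"
    and pure: "\<sigma> \<in> K \<Longrightarrow> \<exists>\<tau>\<in>triangles K. \<sigma> \<subseteq> \<tau>"
    and orientation: "coherent_orientation K T"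
begin

lemma T_triangle: "T i j k \<Longrightarrow> {i, j, k} \<in> triangles K"
  and T_rotate: "T i j k \<Longrightarrow> T j k i"
  and T_swap: "{i, j, k} \<in> triangles K \<Longrightarrow> T i j k \<longleftrightarrow> \<not> T j i k"
  and T_unique: "T i j k \<Longrightarrow> T i j l \<Longrightarrow> k = l"
proof -
  note o = orientation[unfolded coherent_orientation_def]
  show "T i j k \<Longrightarrow> {i, j, k} \<in> triangles K"
    using conjunct1[OF o] by simp
  show "T i j k \<Longrightarrow> T j k i"
    using conjunct1[OF conjunct2[OF o]] by simp
  show "{i, j, k} \<in> triangles K \<Longrightarrow> T i j k \<longleftrightarrow> \<not> T j i k"
    using conjunct1[OF conjunct2[OF conjunct2[OF o]]] by simp
  show "T i j k \<Longrightarrow> T i j l \<Longrightarrow> k = l"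
    using conjunct2[OF conjunct2[OF conjunct2[OF o]]] by simp
qed

lemma T_triangle': "T j i k \<Longrightarrow> {i, j, k} \<in> triangles K"
  by (metis T_triangle insert_commute)

lemma T_distinct: "T i j k \<Longrightarrow> i \<noteq> j \<and> j \<noteq> k \<and> i \<noteq> k"
  using T_triangle[of i j k] by (auto simp: triangles_def card_insert_if split: if_splits)

lemma T_unique': "T i k j \<Longrightarrow> T i l j \<Longrightarrow> k = l"
  by (metis T_rotate T_unique)

lemma T_asym: "T i j k \<Longrightarrow> \<not> T j i k"
  using T_triangle T_swap by blast

lemma simplex_face: "\<lbrakk>\<sigma> \<in> K; \<tau> \<subseteq> \<sigma>; \<tau> \<noteq> {}\<rbrakk> \<Longrightarrow> \<tau> \<in> K"
  using complex unfolding abstract_simplicial_complex_def by blast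

lemma triangles_subset: "triangles K \<subseteq> K"
  by (auto simp: triangles_def)

lemma triangle_through_edge:
  assumes "t \<in> triangles K" "{i, j} \<subseteq> t" "i \<noteq> j"
  obtains k where "t = {i, j, k}" "T i j k \<or> T j i k"
proof -
  have "card (t - {i, j}) = 1"
    using assms by (subst card_Diff_subset) (auto simp: triangles_def)
  then obtain k where "t - {i, j} = {k}" by (auto simp: card_1_singleton_iff)
  then have "t = {i, j, k}" using assms by auto
  then show ?thesis using that assms(1) T_swap by blast
qed

lemma edge_iff: "{i, j} \<in> edges K \<longleftrightarrow> (\<exists>k. T i j k \<or> T j i k)"
proof
  assume e: "{i, j} \<in> edges K"
  then have "i \<noteq> j" by (auto simp: edges_def)
  then show "\<exists>k. T i j k \<or> T j i k"
    using e pure triangle_through_edge unfolding edges_def by (metis (no_types, lifting) mem_Collect_eq)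
next
  assume "\<exists>k. T i j k \<or> T j i k"
  then obtain k where k: "T i j k \<or> T j i k" by blast
  then have "{i, j, k} \<in> triangles K" "i \<noteq> j"
    using T_triangle T_triangle' T_distinct by blast+
  then show "{i, j} \<in> edges K"
    using simplex_face[of "{i, j, k}" "{i, j}"] triangles_subset by (auto simp: edges_def)
qed

text \<open>By \<open>T_unique\<close> each direction of the edge belongs to at most one triangle,
  so two triangles at the edge means one on either side. In the converse direction
  \<open>T_asym\<close> keeps the two triangles apart.\<close>

lemma interior_edge_iff: "{i, j} \<in> interior_edges K \<longleftrightarrow> (\<exists>k. T i j k) \<and> (\<exists>l. T j i l)"
proof (cases "{i, j} \<in> edges K")
  case False
  then show ?thesis by (simp add: interior_edges_def edge_iff)
next
  case True
  let ?F = "{t \<in> triangles K. {i, j} \<subseteq> t}"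
  have ij: "i \<noteq> j" using True by (auto simp: edges_def)
  have F: "t \<in> ?F \<longleftrightarrow> (\<exists>k. t = {i, j, k} \<and> (T i j k \<or> T j i k))" for t
  proof
    assume "t \<in> ?F"
    then have "t \<in> triangles K" "{i, j} \<subseteq> t" by simp_all
    then show "\<exists>k. t = {i, j, k} \<and> (T i j k \<or> T j i k)"
      using ij by (elim triangle_through_edge) auto
  next
    assume "\<exists>k. t = {i, j, k} \<and> (T i j k \<or> T j i k)"
    then obtain k where k: "t = {i, j, k}" "T i j k \<or> T j i k" by metis
    then have "t \<in> triangles K" using T_triangle T_triangle' by metis
    then show "t \<in> ?F" using k(1) by simp
  qed
  show ?thesis
  proof
    assume "{i, j} \<in> interior_edges K"
    then have "card ?F = 2" by (simp add: interior_edges_def)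
    then obtain t t' where tt: "?F = {t, t'}" "t \<noteq> t'"
      unfolding card_2_iff by metis
    then have "t \<in> ?F" "t' \<in> ?F" by simp_all
    then obtain k l where kl: "t = {i, j, k}" "t' = {i, j, l}" "T i j k \<or> T j i k" "T i j l \<or> T j i l"
      unfolding F by metis
    then have "k \<noteq> l" using tt by auto
    then show "(\<exists>k. T i j k) \<and> (\<exists>l. T j i l)"
      using kl(3,4) T_unique by metis
  next
    assume "(\<exists>k. T i j k) \<and> (\<exists>l. T j i l)"
    then obtain k l where kl: "T i j k" "T j i l" by blast
    have "T i j k' \<longleftrightarrow> k' = k" "T j i k' \<longleftrightarrow> k' = l" for k'
      using kl T_unique by metis+
    then have "t \<in> ?F \<longleftrightarrow> t \<in> {{i, j, k}, {i, j, l}}" for t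
      unfolding F by auto
    then have "?F = {{i, j, k}, {i, j, l}}" by (rule set_eqI)
    moreover have "k \<noteq> l" using kl T_asym by blast
    then have "k \<notin> {i, j, l}"
      using T_distinct[OF kl(1)] by auto
    then have "{i, j, k} \<noteq> {i, j, l}" by blast
    ultimately show "{i, j} \<in> interior_edges K"
      using True by (simp add: interior_edges_def)
  qed
qed

lemma neighbour_iff: "j \<in> neighbours K v \<longleftrightarrow> (\<exists>k. T v j k \<or> T v k j)"
  unfolding neighbours_def mem_Collect_eq edge_iff using T_rotate by metis

lemma neighbour_neq: "j \<in> neighbours K v \<Longrightarrow> j \<noteq> v"
  using neighbour_iff T_distinct by metis

text \<open>Rotated to begin at \<open>v\<close>, the relation \<open>T v j k\<close> says that
  \<open>k\<close> follows \<open>j\<close> in the link of \<open>v\<close>. This reading in terms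
  of successors and predecessors underlies the computations around a vertex.\<close>

lemma interior_edge_iff': "{v, j} \<in> interior_edges K \<longleftrightarrow> (\<exists>k. T v j k) \<and> (\<exists>l. T v l j)"
  unfolding interior_edge_iff using T_rotate by metis

lemma interior_vertex_iff:
  "v \<in> interior_vertices K \<longleftrightarrow> v \<in> vertices K \<and> (\<forall>j\<in>neighbours K v. {v, j} \<in> interior_edges K)"
proof -
  have "\<exists>j. e = {v, j}" if "e \<in> edges K" "v \<in> e" for e
    using that by (auto simp: edges_def card_2_iff insert_commute)
  then show ?thesis unfolding interior_vertices_def neighbours_def by blast
qed

lemma left_face_eq: "T i j k \<Longrightarrow> left_face T i j = {i, j, k}"
  unfolding left_face_def using T_unique by (metis the_equality)

lemma right_face_eq: "T j i k \<Longrightarrow> right_face T i j = {j, i, k}"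
  unfolding right_face_def using T_unique by (metis the_equality)

lemma dual_diff_eq:
  "\<lbrakk>T v j k; T v l j\<rbrakk> \<Longrightarrow> dual_diff T f v j = f {v, j, k} - f {v, l, j}"
  unfolding dual_diff_def using left_face_eq[of v j k] right_face_eq[of j v l] T_rotate[of v l j] T_rotate[of l j v]
  by (simp add: insert_commute)

lemma dual_diff_commute: "dual_diff T f j i = - dual_diff T f i j"
  by (simp add: dual_diff_def left_face_def right_face_def)

text \<open>At an interior vertex every link vertex has a successor. The successor map is injective
  on a finite set, hence a permutation, and it carries left faces to right faces, so the two sums of
  face values agree.\<close>

lemma sum_dual_diff_eq_0:
  assumes "v \<in> interior_vertices K"
  shows "(\<Sum>j\<in>neighbours K v. dual_diff T f v j) = 0"
proof (cases "finite (neighbours K v)")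
  case True
  have "\<exists>k. T v j k" if "j \<in> neighbours K v" for j
    using assms that by (auto simp: interior_vertex_iff interior_edge_iff')
  then obtain s where s: "\<And>j. j \<in> neighbours K v \<Longrightarrow> T v j (s j)" by metis
  have "inj_on s (neighbours K v)"
    using s T_unique' by (intro inj_onI) metis
  moreover have "s ` neighbours K v \<subseteq> neighbours K v"
    using s neighbour_iff by blast
  ultimately have bij: "bij_betw s (neighbours K v) (neighbours K v)"
    using endo_inj_surj[OF True] by (simp add: bij_betw_def)
  have "right_face T v (s j) = left_face T v j" if "j \<in> neighbours K v" for j
    using right_face_eq[of "s j" v j] left_face_eq[OF s[OF that]] T_rotate s[OF that]
    by (simp add: insert_commute) 
  then have "(\<Sum>j\<in>neighbours K v. f (left_face T v j)) = (\<Sum>j\<in>neighbours K v. f (right_face T v (s j)))"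
    by (intro sum.cong) auto
  also have "\<dots> = (\<Sum>j\<in>neighbours K v. f (right_face T v j))"
    by (rule sum.reindex_bij_betw[OF bij])
  finally show ?thesis by (simp add: dual_diff_def sum_subtractf)
qed simp

text \<open>Stated with unions of components instead of chains of adjacent vertices: a separation of
  a punctured neighbourhood contradicts exactly this form, and it shows at once that a cycle in the
  link is the whole link.\<close>

definition link_connected :: "'v \<Rightarrow> bool" where
  "link_connected v \<longleftrightarrow> (\<forall>C \<subseteq> neighbours K v.
     (\<forall>j k. T v j k \<longrightarrow> (j \<in> C \<longleftrightarrow> k \<in> C)) \<longrightarrow> C = {} \<or> C = neighbours K v)"

text \<open>Only a cycle of the predecessor map can obstruct integration around \<open>v\<close>.
  Such a cycle is closed under adjacency, so by connectedness it is the whole link; then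
  \<open>v\<close> is interior and \<open>closed\<close> applies to it.\<close>

lemma ex_local_potential:
  fixes \<omega> :: "'v \<Rightarrow> 'b::ab_group_add"
  assumes conn: "link_connected v" and v: "v \<in> vertices K"
    and closed: "v \<in> interior_vertices K \<Longrightarrow> (\<Sum>j\<in>neighbours K v. \<omega> j) = 0"
  shows "\<exists>g. \<forall>j k l. T v j k \<and> T v l j \<longrightarrow> g {v, j, k} - g {v, l, j} = \<omega> j"
proof -
  txt \<open>A triangle at \<open>v\<close> is indexed by its first vertex after \<open>v\<close>. The predecessor map on the link is
    made total by fixing the vertices without predecessor.\<close>
  define \<nu> where "\<nu> = (\<lambda>j. if \<exists>l. T v l j then THE l. T v l j else j)"
  have \<nu>: "\<nu> j = l" if "T v l j" for j l
    using that T_unique' unfolding \<nu>_def by (metis the_equality)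
  define D where "D = {j. \<exists>l. T v l j}"
  have \<nu>D: "T v (\<nu> j) j" if "j \<in> D" for j
    using that \<nu> by (auto simp: D_def)
  have \<nu>notD: "\<nu> j = j" if "j \<notin> D" for j
    using that by (auto simp: D_def \<nu>_def)
  \<comment> \<open>The sign is negative because \<nu> runs against the orientation of the link. The
    value 0 outside \<open>D\<close> makes the artificial fixed points satisfy the cycle
    condition.\<close>
  define w where "w = (\<lambda>j. if j \<in> D then - \<omega> j else 0)"
  have "(\<Sum>i<n. w ((\<nu> ^^ i) x)) = 0"
    if period: "(\<nu> ^^ n) x = x" and inj: "inj_on (\<lambda>i. (\<nu> ^^ i) x) {..<n}" for x n
  proof (cases "n > 0 \<and> x \<in> D")
    case False
    have "(\<nu> ^^ i) x = x" if "x \<notin> D" for i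
      by (induction i) (use \<nu>notD that in auto)
    then show ?thesis using False by (auto simp: w_def)
  next
    case True
    define C where "C = (\<lambda>i. (\<nu> ^^ i) x) ` {..<n}"
    have \<nu>C: "\<nu> j \<in> C" if j: "j \<in> C" for j
    proof -
      obtain i where i: "i < n" "j = (\<nu> ^^ i) x" using j by (auto simp: C_def)
      then have "\<nu> j = (\<nu> ^^ Suc i) x" by simp
      then show ?thesis
      proof (cases "Suc i = n")
        case True
        then show ?thesis using \<open>\<nu> j = _\<close> period \<open>n > 0 \<and> x \<in> D\<close> by (auto simp: C_def image_iff intro!: bexI[of _ 0])
      next
        case False
        then show ?thesis using \<open>\<nu> j = _\<close> i by (auto simp: C_def simp del: funpow.simps)
      qed
    qed
    have pred: "\<exists>j'\<in>C. j = \<nu> j'" if j: "j \<in> C" for j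
    proof -
      obtain i where i: "i < n" "j = (\<nu> ^^ i) x" using j by (auto simp: C_def)
      show ?thesis
      proof (cases i)
        case 0
        then have "j = \<nu> ((\<nu> ^^ (n - 1)) x)"
          using i period True by (metis Suc_pred' comp_apply funpow.simps(2) funpow_0)
        then show ?thesis using True by (auto simp: C_def)
      next
        case (Suc i')
        then show ?thesis using i by (auto simp: C_def)
      qed
    qed
    \<comment> \<open>An orbit that leaves \<open>D\<close> has reached a fixed point; by
      periodicity this point is \<open>x\<close>, which lies in \<open>D\<close>.\<close>
    have CD: "C \<subseteq> D"
    proof (rule ccontr)
      assume "\<not> C \<subseteq> D"
      then obtain i where i: "i < n" "(\<nu> ^^ i) x \<notin> D" by (auto simp: C_def)
      have "(\<nu> ^^ (m + i)) x = (\<nu> ^^ i) x" for m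
        by (induction m) (use \<nu>notD i in auto)
      from this[of "n - i"] show False using i True period by simp
    qed
    have "j \<in> C \<longleftrightarrow> k \<in> C" if jk: "T v j k" for j k
    proof
      assume "k \<in> C"
      then show "j \<in> C" using \<nu>C \<nu>[OF jk] by metis
    next
      assume "j \<in> C"
      then obtain j' where j': "j' \<in> C" "j = \<nu> j'" using pred by blast
      then have "T v j j'" using CD \<nu>D by blast
      then show "k \<in> C" using jk T_unique j' by metis
    qed
    moreover have CN: "C \<subseteq> neighbours K v"
      using CD unfolding D_def subset_iff mem_Collect_eq neighbour_iff by blast
    moreover have "C \<noteq> {}" using True by (auto simp: C_def)
    ultimately have N: "neighbours K v = C"
      using conn unfolding link_connected_def by blast
    have "{v, j} \<in> interior_edges K" if j: "j \<in> C" for j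
    proof -
      obtain j' where "j' \<in> C" "j = \<nu> j'" using pred[OF j] by blast
      then have "T v j j'" using CD \<nu>D by blast
      then show ?thesis using \<nu>D j CD by (auto simp: interior_edge_iff')
    qed
    then have "v \<in> interior_vertices K" using v N by (simp add: interior_vertex_iff)
    then have "(\<Sum>j\<in>C. \<omega> j) = 0" using closed N by simp
    moreover have "(\<Sum>j\<in>C. w j) = (\<Sum>j\<in>C. - \<omega> j)"
      using CD by (intro sum.cong) (auto simp: w_def)
    moreover have "(\<Sum>j\<in>C. w j) = (\<Sum>i<n. w ((\<nu> ^^ i) x))"
      unfolding C_def by (subst sum.reindex[OF inj]) simp
    ultimately show ?thesis by (simp add: sum_negf)
  qed
  then obtain a where a: "\<And>j. a (\<nu> j) = a j + w j"
    using ex_coboundary_of_map[of \<nu> w] by metis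
  \<comment> \<open>The description is unique on a triangle at \<open>v\<close>, since
    \<open>T v j k\<close> excludes \<open>T v k j\<close>.\<close>
  define g where "g = (\<lambda>t. a (THE j. \<exists>k. T v j k \<and> t = {v, j, k}))"
  have g: "g {v, j, k} = a j" if "T v j k" for j k
  proof -
    have "j' = j" if "T v j' k'" "{v, j, k} = {v, j', k'}" for j' k'
    proof -
      have "{j, k} = {j', k'}"
        using that T_distinct[OF that(1)] T_distinct[OF \<open>T v j k\<close>] by (auto simp: set_eq_iff)
      moreover have "\<not> T v k j"
        using T_asym \<open>T v j k\<close> T_rotate by metis
      ultimately show ?thesis using that(1) by (auto simp: doubleton_eq_iff)
    qed
    then have "(THE j'. \<exists>k'. T v j' k' \<and> {v, j, k} = {v, j', k'}) = j"
      using \<open>T v j k\<close> by (intro the_equality) blast+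
    then show ?thesis by (simp add: g_def)
  qed
  have "g {v, j, k} - g {v, l, j} = \<omega> j" if "T v j k" "T v l j" for j k l
    using g[OF that(1)] g[OF that(2)] a[of j] \<nu>[OF that(2)] that by (auto simp: w_def D_def)
  then show ?thesis by blast
qed

end

lemma (in oriented_complex) realization_edge:
  assumes "realization K z" "T i j k"
  shows "z i \<noteq> z j" "z j \<noteq> z k" "z i \<noteq> z k"
proof -
  have "\<not> collinear {z i, z j, z k}"
    using assms T_triangle[of i j k] by (auto simp: realization_def)
  then show "z i \<noteq> z j" "z j \<noteq> z k" "z i \<noteq> z k"
    by (auto simp: insert_commute)
qed

lemma (in oriented_complex) spherical_realization_inverse_stereographic:
  assumes "realization K z"
  shows "spherical_realization K (\<lambda>v. inverse_stereographic (z v))"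
proof -
  have "\<not> collinear ((\<lambda>v. inverse_stereographic (z v)) ` t)" if t: "t \<in> triangles K" for t
  proof -
    obtain i j k where ijk: "t = {i, j, k}"
      using t by (auto simp: triangles_def card_3_iff)
    then have "T i j k \<or> T j i k" using T_swap t by metis
    then have "z i \<noteq> z j" "z j \<noteq> z k" "z i \<noteq> z k"
      using realization_edge[OF assms] by metis+
    then show ?thesis
      unfolding ijk image_insert image_empty
      by (intro not_collinear_sphere) (simp_all add: norm_inverse_stereographic)
  qed
  then show ?thesis
    by (auto simp: spherical_realization_def realization_def norm_inverse_stereographic)
qed

section \<open>Cech cocycles on simply connected spaces\<close>


lemma openin_UN: "(\<And>i. i \<in> I \<Longrightarrow> openin X (A i)) \<Longrightarrow> openin X (\<Union>i\<in>I. A i)"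
  by (rule openin_Union) auto

text \<open>The cover is indexed by a whole type and may have empty members. The cocycle identity is
  required only at common points of three members; in particular it gives \<open>c v v = 0\<close>
  only for nonempty \<open>U v\<close>.\<close>

locale cech_cocycle =
  fixes X :: "'a topology" and U :: "'i \<Rightarrow> 'a set" and c :: "'i \<Rightarrow> 'i \<Rightarrow> 'b::ab_group_add"
  assumes openin_cover: "openin X (U v)"
    and cover: "topspace X \<subseteq> (\<Union>v. U v)"
    and cocycle: "\<lbrakk>x \<in> U u; x \<in> U v; x \<in> U w\<rbrakk> \<Longrightarrow> c u v + c v w = c u w"
begin

text \<open>\<open>c\<close> glues the products of the \<open>U v\<close> with the discrete group to a covering space of \<open>X\<close>. A lift of
  \<open>H\<close> to it is given by its fibre coordinates \<open>\<beta> v\<close> in the charts over \<open>U v\<close>, which are locally constant.\<close>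

definition lift :: "'m::topological_space set \<Rightarrow> ('m \<Rightarrow> 'a) \<Rightarrow> ('i \<Rightarrow> 'm \<Rightarrow> 'b) \<Rightarrow> bool" where
  "lift Q H \<beta> \<longleftrightarrow> H ` Q \<subseteq> topspace X \<and>
     (\<forall>x\<in>Q. \<forall>v w. H x \<in> U v \<and> H x \<in> U w \<longrightarrow> \<beta> v x - \<beta> w x = c v w) \<and>
     (\<forall>v a. openin (top_of_set Q) {x \<in> Q. H x \<in> U v \<and> \<beta> v x = a})"

section \<open>Restriction, uniqueness, gluing and existence of lifts\<close>

lemma lift_diff: "\<lbrakk>lift Q H \<beta>; x \<in> Q; H x \<in> U v; H x \<in> U w\<rbrakk> \<Longrightarrow> \<beta> v x - \<beta> w x = c v w"
  by (simp add: lift_def)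

lemma lift_openin: "lift Q H \<beta> \<Longrightarrow> openin (top_of_set Q) {x \<in> Q. H x \<in> U v \<and> \<beta> v x = a}"
  by (simp add: lift_def)

lemma lift_topspace: "\<lbrakk>lift Q H \<beta>; x \<in> Q\<rbrakk> \<Longrightarrow> H x \<in> topspace X"
  by (simp add: lift_def image_subset_iff)

lemma lift_cover: "\<lbrakk>lift Q H \<beta>; x \<in> Q\<rbrakk> \<Longrightarrow> \<exists>v. H x \<in> U v"
  using lift_topspace cover by blast

text \<open>A change of chart shifts both lifts by the same amount, so agreement at a point is
  independent of the chart.\<close>

lemma lift_eq_iff:
  assumes "lift Q H \<beta>" "lift Q H \<beta>'" "x \<in> Q" "H x \<in> U v" "H x \<in> U w"
  shows "\<beta> v x = \<beta>' v x \<longleftrightarrow> \<beta> w x = \<beta>' w x"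
proof -
  have "\<beta> v x = \<beta> w x + c v w" "\<beta>' v x = \<beta>' w x + c v w"
    using lift_diff[OF assms(1,3-5)] lift_diff[OF assms(2-5)] by (metis add.commute diff_add_cancel)+
  then show ?thesis by simp
qed

lemma lift_compose:
  assumes "lift Q H \<beta>" "continuous_on Q' \<phi>" "\<phi> ` Q' \<subseteq> Q" "\<And>x. x \<in> Q' \<Longrightarrow> H' x = H (\<phi> x)"
  shows "lift Q' H' (\<lambda>v x. \<beta> v (\<phi> x))"
proof -
  have "openin (top_of_set Q') {x \<in> Q'. H' x \<in> U v \<and> \<beta> v (\<phi> x) = a}" for v a
  proof -
    have "openin (top_of_set Q') (Q' \<inter> \<phi> -` {x \<in> Q. H x \<in> U v \<and> \<beta> v x = a})"
      using assms(2,3) by (intro continuous_openin_preimage[where T = Q] lift_openin[OF assms(1)]) auto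
    moreover have "Q' \<inter> \<phi> -` {x \<in> Q. H x \<in> U v \<and> \<beta> v x = a} = {x \<in> Q'. H' x \<in> U v \<and> \<beta> v (\<phi> x) = a}"
      using assms(3,4) by auto
    ultimately show ?thesis by simp
  qed
  moreover have "H' ` Q' \<subseteq> topspace X"
    using lift_topspace[OF assms(1)] assms(3,4) by auto
  moreover have "\<beta> v (\<phi> x) - \<beta> w (\<phi> x) = c v w" if "x \<in> Q'" "H' x \<in> U v" "H' x \<in> U w" for x v w
    using lift_diff[OF assms(1), of "\<phi> x" v w] assms(3,4) that by auto
  ultimately show ?thesis by (simp add: lift_def)
qed

lemma lift_subset: "\<lbrakk>lift Q H \<beta>; Q' \<subseteq> Q\<rbrakk> \<Longrightarrow> lift Q' H \<beta>"
  using lift_compose[of Q H \<beta> Q' "\<lambda>x. x" H] by simp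

lemma lift_shift: "lift Q H \<beta> \<Longrightarrow> lift Q H (\<lambda>v x. \<beta> v x + d)"
proof -
  assume *: "lift Q H \<beta>"
  have "{x \<in> Q. H x \<in> U v \<and> \<beta> v x + d = a} = {x \<in> Q. H x \<in> U v \<and> \<beta> v x = a - d}" for v a
    by (auto simp: algebra_simps)
  with * show ?thesis by (simp add: lift_def)
qed

text \<open>This is the section that is constant in the chart over \<open>U v\<close>; the cocycle
  identity dictates its coordinates in the other charts.\<close>

lemma lift_local:
  assumes "continuous_map (top_of_set Q) X H" "H ` Q \<subseteq> U v"
  shows "lift Q H (\<lambda>w x. c w v)"
proof -
  have "openin (top_of_set Q) {x \<in> Q. H x \<in> U w \<and> c w v = a}" for w a
    using openin_continuous_map_preimage[OF assms(1) openin_cover[of w]]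
    by (cases "c w v = a") auto
  moreover have "c w v - c u v = c w u" if "x \<in> Q" "H x \<in> U w" "H x \<in> U u" for x w u
    using cocycle[of "H x" w u v] assms(2) that by (auto simp: algebra_simps)
  moreover have "H ` Q \<subseteq> topspace X"
    using assms(1) by (auto simp: continuous_map_def Pi_iff)
  ultimately show ?thesis by (simp add: lift_def)
qed

text \<open>The points where the lifts agree and those where they differ are both relatively open,
  because the fibre coordinates are locally constant. They partition the connected set
  \<open>Q\<close>.\<close>

lemma lift_unique:
  assumes "connected Q" "lift Q H \<beta>" "lift Q H \<beta>'"
    and "x\<^sub>0 \<in> Q" "H x\<^sub>0 \<in> U v" "\<beta> v x\<^sub>0 = \<beta>' v x\<^sub>0"
    and "x \<in> Q" "H x \<in> U w"
  shows "\<beta> w x = \<beta>' w x"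
proof (rule ccontr)
  assume neq: "\<beta> w x \<noteq> \<beta>' w x"
  let ?L = "\<lambda>\<beta> w a. {x \<in> Q. H x \<in> U w \<and> \<beta> w x = a}"
  define D where "D = (\<Union>w. \<Union>a. ?L \<beta> w a \<inter> ?L \<beta>' w a)"
  define E where "E = (\<Union>w. \<Union>b. \<Union>a\<in>-{b}. ?L \<beta> w a \<inter> ?L \<beta>' w b)"
  have D: "y \<in> D \<longleftrightarrow> y \<in> Q \<and> (\<exists>w. H y \<in> U w \<and> \<beta> w y = \<beta>' w y)" for y
    by (auto simp: D_def)
  have E: "y \<in> E \<longleftrightarrow> y \<in> Q \<and> (\<exists>w. H y \<in> U w \<and> \<beta> w y \<noteq> \<beta>' w y)" for y
    by (auto simp: E_def)
  have "openin (top_of_set Q) D" "openin (top_of_set Q) E"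
    unfolding D_def E_def
    by (intro openin_UN openin_Int lift_openin[OF assms(2)] lift_openin[OF assms(3)])+
  moreover have "D \<inter> E = {}"
    using lift_eq_iff[OF assms(2,3)] unfolding disjoint_iff D E by metis
  moreover have "Q \<subseteq> D \<union> E"
    using lift_cover[OF assms(2)] unfolding subset_iff Un_iff D E by metis
  moreover have "x\<^sub>0 \<in> D" "x \<in> E"
    unfolding D E using assms neq by blast+
  ultimately show False
    using assms(1) unfolding connected_openin by (metis empty_iff)
qed

text \<open>The second lift is shifted to match the first at one point of the overlap, and by
  uniqueness they then agree on all of it. Closedness of the pieces enters through complements: the
  points outside a level set form a union of two closed sets.\<close>

lemma lift_glue:
  assumes "closed Q1" "closed Q2" "connected (Q1 \<inter> Q2)" "Q1 \<inter> Q2 \<noteq> {}"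
    and 1: "lift Q1 H \<beta>1" and 2: "lift Q2 H \<beta>2"
  shows "\<exists>\<beta>. lift (Q1 \<union> Q2) H \<beta>"
proof -
  obtain x0 v where x0: "x0 \<in> Q1" "x0 \<in> Q2" "H x0 \<in> U v"
    using assms lift_cover[OF 1] by blast
  define \<beta>3 where "\<beta>3 = (\<lambda>w x. \<beta>2 w x + (\<beta>1 v x0 - \<beta>2 v x0))"
  have 3: "lift Q2 H \<beta>3"
    unfolding \<beta>3_def by (rule lift_shift[OF 2])
  have eq: "\<beta>1 w x = \<beta>3 w x" if "x \<in> Q1" "x \<in> Q2" "H x \<in> U w" for w x
    by (rule lift_unique[OF assms(3) lift_subset[OF 1] lift_subset[OF 3], of x0 v])
       (use x0 that in \<open>auto simp: \<beta>3_def\<close>)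
  define \<beta> where "\<beta> = (\<lambda>w x. if x \<in> Q1 then \<beta>1 w x else \<beta>3 w x)"
  have "openin (top_of_set (Q1 \<union> Q2)) {x \<in> Q1 \<union> Q2. H x \<in> U w \<and> \<beta> w x = a}" for w a
  proof -
    let ?C1 = "Q1 - {x \<in> Q1. H x \<in> U w \<and> \<beta>1 w x = a}"
    let ?C2 = "Q2 - {x \<in> Q2. H x \<in> U w \<and> \<beta>3 w x = a}"
    have "closedin (top_of_set Q1) ?C1" "closedin (top_of_set Q2) ?C2"
      using 1 3 by (auto simp: lift_def intro: closedin_diff)
    then have "closed (?C1 \<union> ?C2)"
      using assms(1,2) by (blast intro: closedin_closed_trans)
    then have "openin (top_of_set (Q1 \<union> Q2)) ((Q1 \<union> Q2) \<inter> - (?C1 \<union> ?C2))"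
      by (intro openin_open_Int open_Compl)
    moreover have "(Q1 \<union> Q2) \<inter> - (?C1 \<union> ?C2) = {x \<in> Q1 \<union> Q2. H x \<in> U w \<and> \<beta> w x = a}"
      using eq by (auto simp: \<beta>_def)
    ultimately show ?thesis by simp
  qed
  moreover have "\<beta> w x - \<beta> u x = c w u" if "x \<in> Q1 \<union> Q2" "H x \<in> U w" "H x \<in> U u" for w u x
    using that lift_diff[OF 1] lift_diff[OF 3] by (auto simp: \<beta>_def)
  ultimately have "lift (Q1 \<union> Q2) H \<beta>"
    using 1 2 by (auto simp: lift_def)
  then show ?thesis by blast
qed

lemma lift_exists_square:
  fixes H :: "real \<times> real \<Rightarrow> 'a"
  assumes H: "continuous_map (top_of_set ({0..1} \<times> {0..1})) X H"
  shows "\<exists>\<beta>. lift ({0..1} \<times> {0..1}) H \<beta>"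
proof -
  let ?Q = "{0..1} \<times> {0..1} :: (real \<times> real) set"
  have "\<exists>O'. open O' \<and> {x \<in> ?Q. H x \<in> U v} = ?Q \<inter> O'" for v
    using openin_continuous_map_preimage[OF H openin_cover[of v]] by (auto simp: openin_open)
  then obtain O' where O': "\<And>v. open (O' v)" "\<And>v. {x \<in> ?Q. H x \<in> U v} = ?Q \<inter> O' v"
    by metis
  have HQ: "H x \<in> topspace X" if "x \<in> ?Q" for x
    using H that unfolding continuous_map_def by auto
  have sub: "?Q \<subseteq> \<Union>(range O')"
  proof
    fix x assume x: "x \<in> ?Q"
    then obtain v where "H x \<in> U v" using HQ[OF x] cover by blast
    then show "x \<in> \<Union>(range O')" using x O'(2)[of v] by blast
  qed
  have comp: "compact ?Q" by (intro compact_Times) auto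
  obtain \<delta> where \<delta>: "\<delta> > 0" "\<And>S. \<lbrakk>S \<subseteq> ?Q; diameter S < \<delta>\<rbrakk> \<Longrightarrow> \<exists>B\<in>range O'. S \<subseteq> B"
    by (rule Lebesgue_number_lemma[OF comp _ sub]) (use O'(1) in auto)
  \<comment> \<open>With sides below \<delta>/3 a rectangle has diameter at most 2 \<delta>/3 <
    \<delta>, so the Lebesgue number places it over a single chart.\<close>
  have small: "\<exists>\<beta>. lift ({s..s'} \<times> {t..t'}) H \<beta>"
    if "0 \<le> s" "s' \<le> 1" "0 \<le> t" "t' \<le> 1" "s' - s < \<delta>/3" "t' - t < \<delta>/3" for s s' t t'
  proof -
    let ?S = "{s..s'} \<times> {t..t'}"
    have S: "?S \<subseteq> ?Q" using that by auto
    have "diameter ?S \<le> 2 * \<delta> / 3"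
    proof (rule diameter_le)
      fix x y assume "x \<in> ?S" "y \<in> ?S"
      then have "\<bar>fst x - fst y\<bar> \<le> s' - s" "\<bar>snd x - snd y\<bar> \<le> t' - t"
        by (auto simp: abs_le_iff)
      moreover have "norm (x - y) \<le> \<bar>fst x - fst y\<bar> + \<bar>snd x - snd y\<bar>"
        using norm_Pair_le[of "fst x - fst y" "snd x - snd y"] by (simp add: minus_prod_def)
      ultimately show "norm (x - y) \<le> 2 * \<delta>/3" using that by linarith
    qed (use \<delta> in auto)
    then obtain v where "?S \<subseteq> O' v"
      using \<delta>(2)[OF S] \<delta>(1) by auto
    then have "H ` ?S \<subseteq> U v"
      using S O'(2)[of v] by blast
    moreover have "continuous_map (top_of_set ?S) X H"
      using H S continuous_map_from_subtopology_mono by blast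
    ultimately show ?thesis using lift_local by blast
  qed
  have strip: "\<exists>\<beta>. lift ({s..s'} \<times> {0..1}) H \<beta>"
    if s: "0 \<le> s" "s' \<le> 1" "s' - s < \<delta>/3" "s \<le> s'" for s s'
  proof -
    \<comment> \<open>The rule \<open>Bolzano\<close> passes from small intervals to [0, 1] by
      gluing adjacent ones along a segment. It quantifies over all real intervals, hence the guards
      in \<open>P\<close>. The same argument in the other coordinate then joins the strips.\<close>
    define P where "P = (\<lambda>t t'. 0 \<le> t \<and> t \<le> t' \<and> t' \<le> 1 \<longrightarrow> (\<exists>\<beta>. lift ({s..s'} \<times> {t..t'}) H \<beta>))"
    have "P 0 1"
    proof (rule Bolzano)
      fix a b d :: real assume *: "P a b" "P b d" "a \<le> b" "b \<le> d"
      have e: "{s..s'} \<times> {a..d} = {s..s'} \<times> {a..b} \<union> {s..s'} \<times> {b..d}"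
        and i: "{s..s'} \<times> {a..b} \<inter> {s..s'} \<times> {b..d} = {s..s'} \<times> {b..b}"
        using * by auto
      show "P a d"
        unfolding P_def
      proof
        assume ad: "0 \<le> a \<and> a \<le> d \<and> d \<le> 1"
        then obtain \<beta> \<beta>' where "lift ({s..s'} \<times> {a..b}) H \<beta>" "lift ({s..s'} \<times> {b..d}) H \<beta>'"
          using * unfolding P_def by (meson order_trans)
        then show "\<exists>\<beta>. lift ({s..s'} \<times> {a..d}) H \<beta>"
          unfolding e using s by (intro lift_glue) (auto simp: i closed_Times connected_Times)
      qed
    next
      show "\<exists>d>0. \<forall>a b. a \<le> x \<and> x \<le> b \<and> b - a < d \<longrightarrow> P a b" for x
        using \<delta>(1) small s by (intro exI[of _ "\<delta>/3"]) (auto simp: P_def)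
    qed auto
    then show ?thesis by (simp add: P_def)
  qed
  define P where "P = (\<lambda>s s'. 0 \<le> s \<and> s \<le> s' \<and> s' \<le> 1 \<longrightarrow> (\<exists>\<beta>. lift ({s..s'} \<times> {0..1}) H \<beta>))"
  have "P 0 1"
  proof (rule Bolzano)
    fix a b d :: real assume *: "P a b" "P b d" "a \<le> b" "b \<le> d"
    have e: "{a..d} \<times> {0..1::real} = {a..b} \<times> {0..1} \<union> {b..d} \<times> {0..1}"
      and i: "{a..b} \<times> {0..1::real} \<inter> {b..d} \<times> {0..1} = {b..b} \<times> {0..1}"
      using * by auto
    show "P a d"
      unfolding P_def
    proof
      assume ad: "0 \<le> a \<and> a \<le> d \<and> d \<le> 1"
      then obtain \<beta> \<beta>' where "lift ({a..b} \<times> {0..1}) H \<beta>" "lift ({b..d} \<times> {0..1}) H \<beta>'"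
        using * unfolding P_def by (meson order_trans)
      then show "\<exists>\<beta>. lift ({a..d} \<times> {0..1}) H \<beta>"
        unfolding e by (intro lift_glue) (auto simp: i closed_Times connected_Times)
    qed
  next
    show "\<exists>d>0. \<forall>a b. a \<le> x \<and> x \<le> b \<and> b - a < d \<longrightarrow> P a b" for x
      using \<delta>(1) strip by (intro exI[of _ "\<delta>/3"]) (auto simp: P_def)
  qed auto
  then show ?thesis by (simp add: P_def)
qed

text \<open>The path is regarded as a map on the square that ignores the first coordinate; a slice
  of its lift, shifted to the prescribed initial value, is the required lift.\<close>

lemma lift_exists_path:
  assumes p: "pathin X p" and v: "p 0 \<in> U v"
  shows "\<exists>\<beta>. lift {0..1} p \<beta> \<and> \<beta> v 0 = a"
proof -
  have "continuous_map (top_of_set ({0..1::real} \<times> {0..1::real})) (top_of_set {0..1::real}) snd"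
    by (auto intro!: continuous_intros)
  then have "continuous_map (top_of_set ({0..1::real} \<times> {0..1::real})) X (p \<circ> snd)"
    using p unfolding pathin_def by (rule continuous_map_compose)
  then obtain \<beta> where "lift ({0..1::real} \<times> {0..1::real}) (p \<circ> snd) \<beta>"
    using lift_exists_square by blast
  then have "lift {0..1} p (\<lambda>v t. \<beta> v (0, t))"
    by (rule lift_compose) (auto intro!: continuous_intros)
  from lift_shift[OF this, of "a - \<beta> v (0, 0)"] show ?thesis by force
qed

text \<open>In the homotopy \<open>H (s, t)\<close> with \<open>s\<close> the time and
  \<open>t\<close> the loop parameter, the sides t = 0 and t = 1 trace the same path. Their lifts
  agree at s = 1, where the loop is constant, hence also at s = 0, which is the original
  loop.\<close>

lemma lift_loop:
  assumes sc: "simply_connected_space X" and p: "pathin X p" "p 0 = p 1"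
    and lift: "lift {0..1} p \<beta>" and v: "p 0 \<in> U v"
  shows "\<beta> v 1 = \<beta> v 0"
proof -
  obtain k where "homotopic_with (\<lambda>r. r 0 = r 1) (top_of_set {0..1::real}) X p (\<lambda>_. k)"
    using sc p unfolding simply_connected_space_def by blast
  then obtain H where H: "continuous_map (prod_topology (top_of_set {0..1}) (top_of_set {0..1::real})) X H"
    "\<And>x. H (0, x) = p x" "\<And>x. H (1, x) = k" "\<And>t. t \<in> {0..1::real} \<Longrightarrow> H (t, 0) = H (t, 1)"
    unfolding homotopic_with_def by auto
  then obtain \<gamma> where \<gamma>: "lift ({0..1} \<times> {0..1}) H \<gamma>"
    using lift_exists_square[of H] by auto
  have bottom: "lift {0..1} (\<lambda>t. H (t, 0)) (\<lambda>w t. \<gamma> w (t, 0))"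
    and top: "lift {0..1} (\<lambda>t. H (t, 0)) (\<lambda>w t. \<gamma> w (t, 1))"
    and left: "lift {0..1} p (\<lambda>w x. \<gamma> w (0, x))"
    and right: "lift {0..1} (\<lambda>x. k) (\<lambda>w x. \<gamma> w (1, x))"
    by (rule lift_compose[OF \<gamma>]; force simp: H intro!: continuous_intros)+
  obtain w where w: "k \<in> U w"
    using lift_cover[OF right, of 0] by auto
  have "continuous_map (top_of_set {0..1::real}) X (\<lambda>x. k)"
    using openin_subset[OF openin_cover] w by (auto simp: continuous_map_const)
  \<comment> \<open>A constant lift of the constant loop, shifted to start at
    \<open>\<gamma> w (1, 0)\<close>; uniqueness then makes \<gamma> constant along that
    side.\<close>
  then have "lift {0..1::real} (\<lambda>x. k) (\<lambda>u x. c u w + (\<gamma> w (1, 0) - c w w))"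
    using w by (intro lift_shift lift_local) auto
  from lift_unique[OF _ right this, of 0 w 1 w] w have "\<gamma> w (1, 0) = \<gamma> w (1, 1)"
    by simp
  from lift_unique[OF _ bottom top, of 1 w 0 v] this w v
  have "\<gamma> v (0, 0) = \<gamma> v (0, 1)"
    by (simp add: H)
  moreover have "\<beta> v x = \<gamma> v (0, x) + (\<beta> v 0 - \<gamma> v (0, 0))" if "x \<in> {0..1}" "p x \<in> U v" for x
    by (rule lift_unique[OF _ lift lift_shift[OF left], of 0 v]) (use v that in auto)
  from this[of 1] have "\<beta> v 1 = \<gamma> v (0, 1) + (\<beta> v 0 - \<gamma> v (0, 0))"
    using v p by simp
  ultimately show ?thesis by simp
qed

section \<open>Transport along paths and the global section\<close>

definition join :: "(real \<Rightarrow> 'a) \<Rightarrow> (real \<Rightarrow> 'a) \<Rightarrow> real \<Rightarrow> 'a" where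
  "join p r = (\<lambda>t. if t \<le> 1/2 then p (2 * t) else r (2 * t - 1))"

lemma pathin_join:
  assumes "pathin X p" "pathin X r" "r 0 = p 1"
  shows "pathin X (join p r)"
proof -
  let ?T01 = "top_of_set {0..1::real}"
  show ?thesis
    unfolding pathin_def join_def
  proof (rule continuous_map_cases_le)
    have "continuous_map (subtopology ?T01 {x \<in> topspace ?T01. x \<le> 1/2}) ?T01 ((*) 2)"
      by (auto simp: continuous_map_in_subtopology continuous_map_from_subtopology)
    from continuous_map_compose[OF this assms(1)[unfolded pathin_def]]
    show "continuous_map (subtopology ?T01 {x \<in> topspace ?T01. x \<le> 1/2}) X (\<lambda>t. p (2 * t))"
      by (simp add: o_def)
    have "continuous_map
           (subtopology (top_of_set {0..1}) {x. 0 \<le> x \<and> x \<le> 1 \<and> 1 \<le> x * 2})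
           euclideanreal (\<lambda>t. 2 * t - 1)"
      by (intro continuous_intros) (force intro: continuous_map_from_subtopology)
    then have "continuous_map (subtopology ?T01 {x \<in> topspace ?T01. 1/2 \<le> x}) ?T01 (\<lambda>t. 2 * t - 1)"
      by (force simp: continuous_map_in_subtopology)
    from continuous_map_compose[OF this assms(2)[unfolded pathin_def]]
    show "continuous_map (subtopology ?T01 {x \<in> topspace ?T01. 1/2 \<le> x}) X (\<lambda>t. r (2 * t - 1))"
      by (simp add: o_def)
    show "p (2 * t) = r (2 * t - 1)" if "t = 1 / 2" for t
      unfolding that by (simp add: assms(3))
  qed auto
qed

lemma lift_join:
  assumes "lift {0..1} (join p r) \<beta>" "r 0 = p 1"
  shows "lift {0..1} p (\<lambda>v t. \<beta> v (t / 2))" "lift {0..1} r (\<lambda>v t. \<beta> v ((t + 1) / 2))"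
proof -
  show "lift {0..1} p (\<lambda>v t. \<beta> v (t / 2))"
    by (rule lift_compose[OF assms(1)]) (auto simp: join_def intro!: continuous_intros)
  \<comment> \<open>At t = 0 the argument is 1/2, where \<open>join\<close> still takes its first
    branch; this is where \<open>r 0 = p 1\<close> is needed.\<close>
  have "r t = join p r ((t + 1) / 2)" if "t \<in> {0..1}" for t
  proof -
    have "2 * ((t + 1) / 2) - 1 = t" by (simp add: field_simps)
    then show ?thesis using that assms(2) by (cases "t = 0") (auto simp: join_def)
  qed
  then show "lift {0..1} r (\<lambda>v t. \<beta> v ((t + 1) / 2))"
    by (intro lift_compose[OF assms(1)]) (auto intro!: continuous_intros)
qed

text \<open>The lift of the loop that follows \<open>p\<close> and returns along \<open>p'\<close>
  closes up. By uniqueness its first half is \<beta> and its second half, reversed, is \<beta>', so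
  both end at the value \<gamma> takes at 1/2.\<close>

lemma lift_path_independent:
  assumes sc: "simply_connected_space X"
    and p: "pathin X p" "lift {0..1} p \<beta>" and p': "pathin X p'" "lift {0..1} p' \<beta>'"
    and start: "p' 0 = p 0" "p 0 \<in> U u" "\<beta>' u 0 = \<beta> u 0"
    and finish: "p' 1 = p 1" "p 1 \<in> U v"
  shows "\<beta> v 1 = \<beta>' v 1"
proof -
  define r where "r = (\<lambda>t. p' (1 - t))"
  have r: "r 0 = p 1" "r 1 = p 0" using finish start by (simp_all add: r_def)
  have "continuous_map (top_of_set {0..1::real}) (top_of_set {0..1}) (\<lambda>t. 1 - t)"
    by (auto intro!: continuous_intros)
  from continuous_map_compose[OF this p'(1)[unfolded pathin_def]] have "pathin X r"
    by (simp add: pathin_def r_def o_def)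
  then have L: "pathin X (join p r)" "join p r 0 = p 0" "join p r 1 = p 0"
    using p r by (simp_all add: pathin_join) (simp_all add: join_def)
  then obtain \<gamma> where \<gamma>: "lift {0..1} (join p r) \<gamma>" "\<gamma> u 0 = \<beta> u 0"
    using lift_exists_path[of "join p r" u "\<beta> u 0"] start by auto
  have \<gamma>1: "\<gamma> u 1 = \<beta> u 0"
    using lift_loop[OF sc L(1) _ \<gamma>(1), of u] L \<gamma> start by simp
  have "\<beta> v 1 = \<gamma> v (1 / 2)"
    using lift_unique[OF _ p(2) lift_join(1)[OF \<gamma>(1) r(1)], of 0 u 1 v] start finish \<gamma>(2) by simp
  moreover have "lift {0..1} p' (\<lambda>v t. \<gamma> v ((1 - t + 1) / 2))"
    by (rule lift_compose[OF lift_join(2)[OF \<gamma>(1) r(1)]]) (auto simp: r_def intro!: continuous_intros)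
  from lift_unique[OF _ p'(2) this, of 0 u 1 v] have "\<beta>' v 1 = \<gamma> v (1 / 2)"
    using start finish \<gamma>1 by simp
  ultimately show ?thesis by simp
qed

text \<open>Transporting 0 from a base point along paths is path independent and so defines a global
  section of the covering space. As \<open>U v\<close> is path connected, the coordinate of the
  section there is a constant \<open>h v\<close>, and changing charts at a common point gives the
  formula.\<close>

theorem simply_connected_imp_coboundary:
  assumes sc: "simply_connected_space X" and pc: "\<And>v. path_connectedin X (U v)"
  obtains h where "\<And>v w. U v \<inter> U w \<noteq> {} \<Longrightarrow> c v w = h v - h w"
proof (cases "topspace X = {}")
  case True
  then have "U v = {}" for v
    using openin_subset[OF openin_cover[of v]] by auto
  then show ?thesis by (intro that[of "\<lambda>_. 0"]) simp
next
  case False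
  then obtain x0 where "x0 \<in> topspace X" by blast
  moreover from this obtain u where "x0 \<in> U u" using cover by blast
  ultimately have x0: "x0 \<in> topspace X" "x0 \<in> U u" .
  define reach where "reach = (\<lambda>x v b. \<exists>p \<beta>. pathin X p \<and> p 0 = x0 \<and> p 1 = x \<and>
     lift {0..1} p \<beta> \<and> \<beta> u 0 = 0 \<and> \<beta> v 1 = b)"
  have reachI: "reach x v (\<beta> v 1)"
    if "pathin X p" "p 0 = x0" "p 1 = x" "lift {0..1} p \<beta>" "\<beta> u 0 = 0" for x v p \<beta>
    unfolding reach_def using that by (intro exI[of _ p] exI[of _ \<beta>]) simp
  have reachE: "\<exists>p \<beta>. pathin X p \<and> p 0 = x0 \<and> p 1 = x \<and>
     lift {0..1} p \<beta> \<and> \<beta> u 0 = 0 \<and> \<beta> v 1 = b" if "reach x v b" for x v b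
    using that by (simp add: reach_def)
  have subU: "U v \<subseteq> topspace X" for v
    using openin_subset[OF openin_cover] .
  have reach_ex: "\<exists>b. reach x v b" if "x \<in> U v" for x v
  proof -
    have x: "x \<in> topspace X"
      using that subU by blast
    have "path_connected_space X"
      using sc by (simp add: simply_connected_space_def)
    then obtain p where p: "pathin X p" "p 0 = x0" "p 1 = x"
      unfolding path_connected_space_def using x0(1) x by metis
    then obtain \<beta> where "lift {0..1} p \<beta>" "\<beta> u 0 = 0"
      using lift_exists_path[of p u 0] x0 by auto
    from reachI[OF p this, of v] show ?thesis ..
  qed
  have reach_unique: "b = b'" if b: "reach x v b" "reach x v b'" and x: "x \<in> U v" for x v b b'
  proof -
    obtain p \<beta> p' \<beta>' where "pathin X p" "p 0 = x0" "p 1 = x"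
     "lift {0..1} p \<beta>" "\<beta> u 0 = 0" "\<beta> v 1 = b"  "pathin X p'" "p' 0 = x0" "p' 1 = x"
     "lift {0..1} p' \<beta>'" "\<beta>' u 0 = 0" "\<beta>' v 1 = b'"
      using reachE[OF b(1)] reachE[OF b(2)] by metis
    then show ?thesis
      using lift_path_independent[OF sc, of p \<beta> p' \<beta>' u v] x0 x by simp
  qed
  have reach_diff: "reach x w (b - c v w)" if b: "reach x v b" and x: "x \<in> U v" "x \<in> U w" for x v w b
  proof -
    obtain p \<beta> where p: "pathin X p" "p 0 = x0" "p 1 = x"
     "lift {0..1} p \<beta>" "\<beta> u 0 = 0" "\<beta> v 1 = b"
      using reachE[OF b] by metis
    then have "\<beta> w 1 = b - c v w"
      using lift_diff[OF p(4), of 1 v w] x by (auto simp: algebra_simps)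
    with reachI[OF p(1-5), of w] show ?thesis by simp
  qed
  have reach_move: "reach y v b" if b: "reach x v b" and xy: "x \<in> U v" "y \<in> U v" for x y v b
  proof -
    obtain p \<beta> where p: "pathin X p" "p 0 = x0" "p 1 = x"
     "lift {0..1} p \<beta>" "\<beta> u 0 = 0" "\<beta> v 1 = b"
      using reachE[OF b] by metis
    obtain r where r: "pathin X r" "r ` {0..1} \<subseteq> U v" "r 0 = x" "r 1 = y"
      using pc[of v] xy unfolding path_connectedin by (metis image_subset_iff_funcset)
    have L: "pathin X (join p r)" "join p r 0 = x0" "join p r 1 = y"
      using p r by (simp_all add: pathin_join) (simp_all add: join_def)
    then obtain \<gamma> where \<gamma>: "lift {0..1} (join p r) \<gamma>" "\<gamma> u 0 = 0"
      using lift_exists_path[of "join p r" u 0] x0 by auto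
    have rp: "r 0 = p 1" using r p by simp
    have g: "\<gamma> v (1 / 2) = b"
      using lift_unique[OF _ p(4) lift_join(1)[OF \<gamma>(1) rp], of 0 u 1 v] p x0 xy \<gamma>(2) by simp
    \<comment> \<open>Inside \<open>U v\<close> transport is constant in the chart of
      \<open>v\<close>; the shift gives this coordinate the value \<open>b\<close>.\<close>
    have "lift {0..1} r (\<lambda>w t. c w v + (b - c v v))"
      using r unfolding pathin_def by (intro lift_shift lift_local)
    from lift_unique[OF _ lift_join(2)[OF \<gamma>(1) rp] this, of 0 v 1 v] have "\<gamma> v 1 = b"
      using r xy g by simp
    with reachI[OF L \<gamma>, of v] show ?thesis by simp
  qed
  define h where "h = (\<lambda>v. SOME b. \<exists>x\<in>U v. reach x v b)"
  have h: "reach x v (h v)" if "x \<in> U v" for x v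
  proof -
    have "\<exists>b. \<exists>x\<in>U v. reach x v b"
      using reach_ex[OF that] that by metis
    then have "\<exists>x\<in>U v. reach x v (h v)"
      unfolding h_def by (rule someI_ex)
    then show ?thesis using reach_move that by metis
  qed
  have "c v w = h v - h w" if "U v \<inter> U w \<noteq> {}" for v w
  proof -
    obtain x where x: "x \<in> U v" "x \<in> U w" using \<open>U v \<inter> U w \<noteq> {}\<close> by blast
    have "h v - c v w = h w"
      using reach_unique[OF reach_diff[OF h[OF x(1)] x] h[OF x(2)] x(2)] .
    then show ?thesis by (auto simp: algebra_simps)
  qed
  then show ?thesis using that by blast
qed

end

section \<open>Topology of the underlying space\<close>


lemma closed_simplex_convex:
  assumes "\<alpha> \<in> closed_simplex \<sigma>" "\<beta> \<in> closed_simplex \<sigma>" "0 \<le> t" "t \<le> 1"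
  shows "(\<lambda>v. (1 - t) * \<alpha> v + t * \<beta> v) \<in> closed_simplex \<sigma>"
  using assms unfolding closed_simplex_def
  by (auto simp: sum.distrib sum_distrib_left[symmetric])

definition vertex_point :: "'v \<Rightarrow> 'v \<Rightarrow> real" where
  "vertex_point v = (\<lambda>w. if w = v then 1 else 0)"

lemma vertex_point_in_simplex: "\<lbrakk>finite \<sigma>; v \<in> \<sigma>\<rbrakk> \<Longrightarrow> vertex_point v \<in> closed_simplex \<sigma>"
  by (auto simp: closed_simplex_def vertex_point_def)

definition open_star :: "'v set set \<Rightarrow> 'v \<Rightarrow> ('v \<Rightarrow> real) set" where
  "open_star K v = {\<alpha> \<in> \<Union> (closed_simplex ` K). 0 < \<alpha> v}"

lemma topspace_underlying_space: "topspace (underlying_space K) = \<Union> (closed_simplex ` K)"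
proof -
  have "openin (underlying_space K) (\<Union> (closed_simplex ` K))"
    unfolding openin_underlying_space by (auto simp: Int_absorb1 UN_upper)
  moreover have "topspace (underlying_space K) \<subseteq> \<Union> (closed_simplex ` K)"
    using openin_topspace[of "underlying_space K"] unfolding openin_underlying_space by blast
  ultimately show ?thesis
    using openin_subset by blast
qed

lemma openin_open_star: "openin (underlying_space K) (open_star K v)"
  unfolding openin_underlying_space
proof (intro conjI ballI)
  fix \<sigma> assume "\<sigma> \<in> K"
  then have "open_star K v \<inter> closed_simplex \<sigma> = closed_simplex \<sigma> \<inter> (\<lambda>\<alpha>. \<alpha> v) -` {0<..}"
    by (auto simp: open_star_def)
  moreover have "open ((\<lambda>\<alpha>::'a \<Rightarrow> real. \<alpha> v) -` {0<..})"
    by (intro open_vimage continuous_on_product_coordinates) auto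
  ultimately show "openin (top_of_set (closed_simplex \<sigma>)) (open_star K v \<inter> closed_simplex \<sigma>)"
    by (simp add: openin_open_Int)
qed (auto simp: open_star_def)

text \<open>The weak topology makes the inclusion of each closed simplex continuous. The explicit
  paths constructed later each stay in one simplex.\<close>

lemma continuous_map_into_underlying_space:
  assumes "\<sigma> \<in> K" "continuous_map X (top_of_set (closed_simplex \<sigma>)) f"
  shows "continuous_map X (underlying_space K) f"
proof -
  have "continuous_map (top_of_set (closed_simplex \<sigma>)) (underlying_space K) (\<lambda>x. x)"
    unfolding continuous_map_def
  proof (intro conjI allI impI)
    fix U assume "openin (underlying_space K) U"
    then have "openin (top_of_set (closed_simplex \<sigma>)) (U \<inter> closed_simplex \<sigma>)"
      using assms(1) unfolding openin_underlying_space by blast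
    then show "openin (top_of_set (closed_simplex \<sigma>)) {x \<in> topspace (top_of_set (closed_simplex \<sigma>)). x \<in> U}"
      by (simp add: Int_def conj_commute)
  qed (use assms(1) in \<open>auto simp: topspace_underlying_space\<close>)
  from continuous_map_compose[OF assms(2) this] show ?thesis by (simp add: o_def)
qed

lemma pathin_segment:
  assumes "\<sigma> \<in> K" "\<alpha> \<in> closed_simplex \<sigma>" "\<beta> \<in> closed_simplex \<sigma>"
  shows "pathin (underlying_space K) (\<lambda>t v. (1 - t) * \<alpha> v + t * \<beta> v)"
  unfolding pathin_def
proof (rule continuous_map_into_underlying_space[OF assms(1)])
  have "continuous_on {0..1::real} (\<lambda>t v. (1 - t) * \<alpha> v + t * \<beta> v)"
    by (intro continuous_on_coordinatewise_then_product continuous_intros)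
  then show "continuous_map (top_of_set {0..1}) (top_of_set (closed_simplex \<sigma>)) (\<lambda>t v. (1 - t) * \<alpha> v + t * \<beta> v)"
    using closed_simplex_convex[OF assms(2,3)] by auto
qed

text \<open>The star is contracted to its centre: on the segment from \<alpha> to the vertex the
  coordinate at \<open>v\<close> is (1 - t) \<alpha> v + t, which stays positive.\<close>

lemma path_connectedin_open_star:
  assumes "abstract_simplicial_complex K"
  shows "path_connectedin (underlying_space K) (open_star K v)"
proof -
  let ?X = "subtopology (underlying_space K) (open_star K v)"
  have top: "topspace ?X = open_star K v"
    using openin_subset[OF openin_open_star] by fastforce
  have "path_component_of ?X \<alpha> (vertex_point v)" if \<alpha>: "\<alpha> \<in> open_star K v" for \<alpha>
  proof -
    obtain \<sigma> where \<sigma>: "\<sigma> \<in> K" "\<alpha> \<in> closed_simplex \<sigma>" "\<alpha> v > 0"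
      using \<alpha> by (auto simp: open_star_def)
    then have "v \<in> \<sigma>" by (metis (mono_tags, lifting) closed_simplex_def less_irrefl mem_Collect_eq)
    moreover have "finite \<sigma>"
      using assms \<sigma> by (auto simp: abstract_simplicial_complex_def)
    ultimately have vp: "vertex_point v \<in> closed_simplex \<sigma>"
      by (intro vertex_point_in_simplex)
    let ?g = "\<lambda>t w. (1 - t) * \<alpha> w + t * vertex_point v w"
    have "?g t \<in> open_star K v" if "t \<in> {0..1}" for t
    proof -
      have "(1 - t) * \<alpha> v + t > 0"
        using that \<sigma>(3) by (cases "t = 0") (auto intro!: add_nonneg_pos)
      moreover have "?g t \<in> closed_simplex \<sigma>"
        using closed_simplex_convex[OF \<sigma>(2) vp] that by simp
      ultimately show ?thesis
        using \<sigma>(1) by (auto simp: open_star_def vertex_point_def)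
    qed
    then have "pathin ?X ?g"
      unfolding pathin_subtopology using pathin_segment[OF \<sigma>(1,2) vp] by blast
    then show ?thesis
      unfolding path_component_of_def by (intro exI[of _ ?g]) auto
  qed
  then have "path_connected_space ?X"
    unfolding path_connected_space_iff_path_component top
    by (meson path_component_of_sym path_component_of_trans)
  then show ?thesis
    using openin_subset[OF openin_open_star] by (simp add: path_connectedin_def)
qed

lemma open_star_cover:
  assumes "abstract_simplicial_complex K"
  shows "topspace (underlying_space K) \<subseteq> (\<Union>v. open_star K v)"
proof
  fix \<alpha> assume "\<alpha> \<in> topspace (underlying_space K)"
  then obtain \<sigma> where \<sigma>: "\<sigma> \<in> K" "\<alpha> \<in> closed_simplex \<sigma>"
    by (auto simp: topspace_underlying_space)
  then have "sum \<alpha> \<sigma> = 1" and nonneg: "\<And>v. 0 \<le> \<alpha> v"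
    by (simp_all add: closed_simplex_def)
  then obtain v where "\<alpha> v \<noteq> 0"
    by (metis sum.neutral zero_neq_one)
  then have "0 < \<alpha> v"
    using nonneg[of v] by simp
  then have "\<alpha> \<in> open_star K v"
    using \<sigma> by (auto simp: open_star_def)
  then show "\<alpha> \<in> (\<Union>v. open_star K v)" by blast
qed

lemma open_star_Int_simplex:
  assumes "\<alpha> \<in> topspace (underlying_space K)"
  obtains \<sigma> where "\<sigma> \<in> K" "\<And>v. 0 < \<alpha> v \<Longrightarrow> v \<in> \<sigma>"
proof -
  obtain \<sigma> where \<sigma>: "\<sigma> \<in> K" "\<alpha> \<in> closed_simplex \<sigma>"
    using assms by (auto simp: topspace_underlying_space)
  have "v \<in> \<sigma>" if "0 < \<alpha> v" for v
    using \<sigma>(2) that by (cases "v \<in> \<sigma>") (simp_all add: closed_simplex_def)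
  with \<sigma>(1) show thesis by (rule that)
qed

text \<open>In the local model, removing a point from a convex set that is not contained in a line leaves
  it connected, also when the point lies on the boundary of the half plane.\<close>

lemma surface_punctured_neighbourhood:
  assumes "surface_with_boundary X" "openin X V" "x \<in> V"
  obtains W where "openin X W" "x \<in> W" "W \<subseteq> V" "connectedin X (W - {x})"
proof -
  let ?P = "{w::complex. 0 \<le> Im w}"
  have "x \<in> topspace X" using assms(2,3) openin_subset by blast
  then obtain U S where US: "openin X U" "x \<in> U" "openin (top_of_set ?P) S"
    "subtopology X U homeomorphic_space top_of_set S"
    using assms(1) unfolding surface_with_boundary_def by metis
  then obtain f g where fg: "homeomorphic_maps (subtopology X U) (top_of_set S) f g"
    unfolding homeomorphic_space_def by metis
  have topU: "topspace (subtopology X U) = U"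
    using openin_subset[OF US(1)] by (simp add: inf.absorb2)
  have "open_map (subtopology X U) (top_of_set S) f"
    using fg homeomorphic_maps_map homeomorphic_imp_open_map by metis
  moreover have "openin (subtopology X U) (U \<inter> V)"
    using assms(2) by (rule openin_subtopology_Int2)
  ultimately have "openin (top_of_set S) (f ` (U \<inter> V))"
    by (simp add: open_map_def)
  then have "openin (top_of_set ?P) (f ` (U \<inter> V))"
    using US(3) by (rule openin_trans)
  then have ball: "f ` (U \<inter> V) \<subseteq> ?P" "\<forall>y\<in>f ` (U \<inter> V). \<exists>\<epsilon>>0. ball y \<epsilon> \<inter> ?P \<subseteq> f ` (U \<inter> V)"
    unfolding openin_contains_ball by auto
  have fx: "f x \<in> f ` (U \<inter> V)" using US(2) assms(3) by (intro imageI IntI)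
  obtain \<epsilon> where \<epsilon>: "\<epsilon> > 0" "ball (f x) \<epsilon> \<inter> ?P \<subseteq> f ` (U \<inter> V)"
    using bspec[OF ball(2) fx] by metis
  have fxP: "f x \<in> ?P" using ball(1) fx by (rule subsetD)
  let ?B = "ball (f x) \<epsilon> \<inter> ?P"
  have fU: "f u \<in> S" if "u \<in> U" for u
    using fg that topU unfolding homeomorphic_maps_def continuous_map_def by auto
  have BS: "?B \<subseteq> S" using \<epsilon>(2) fU by auto
  have gf: "g (f u) = u" if "u \<in> U" for u
    using fg that topU unfolding homeomorphic_maps_def by auto
  have fgs: "f (g s) = s" if "s \<in> S" for s
    using fg that unfolding homeomorphic_maps_def by auto
  have gcont: "continuous_map (top_of_set S) (subtopology X U) g"
    using fg unfolding homeomorphic_maps_def by blast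
  have "open_map (top_of_set S) (subtopology X U) g"
    using fg homeomorphic_maps_map homeomorphic_imp_open_map homeomorphic_maps_sym by metis
  moreover have "openin (top_of_set S) ?B"
  proof -
    have "openin (top_of_set ?P) ?B" by (metis Int_commute open_ball openin_open_Int)
    then show ?thesis
      using BS openin_imp_subset[OF US(3)] by (rule openin_subset_trans)
  qed
  ultimately have "openin (subtopology X U) (g ` ?B)"
    by (simp add: open_map_def)
  then have openW: "openin X (g ` ?B)"
    using US(1) openin_trans_full by metis
  have "convex ?P"
    using convex_halfspace_Im_ge[of 0] by simp
  then have "convex ?B"
    by (intro convex_Int) auto
  moreover have "\<not> collinear ?B"
  proof -
    \<comment> \<open>A disc of half the radius is raised by \<epsilon>/2, so it fits into the half
      plane even when \<open>f x\<close> lies on the boundary line. It makes \<open>?B\<close>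
      two-dimensional.\<close>
    have "ball (f x + \<i> * of_real (\<epsilon>/2)) (\<epsilon>/2) \<subseteq> ?B"
    proof
      fix y assume y: "y \<in> ball (f x + \<i> * of_real (\<epsilon>/2)) (\<epsilon>/2)"
      have "cmod (y - f x) \<le> cmod (y - (f x + \<i> * of_real (\<epsilon>/2))) + cmod (\<i> * of_real (\<epsilon>/2))"
        by (metis add.commute add_diff_cancel_left' diff_add_eq_diff_diff_swap norm_triangle_sub)
      moreover have "cmod (\<i> * of_real (\<epsilon>/2)) = \<epsilon>/2"
        using \<epsilon>(1) by (simp add: norm_mult)
      moreover have yn: "cmod (y - (f x + \<i> * of_real (\<epsilon>/2))) < \<epsilon>/2"
        using y by (simp add: dist_norm norm_minus_commute)
      ultimately have "cmod (y - f x) < \<epsilon>" by linarith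
      moreover have "\<bar>Im (y - (f x + \<i> * of_real (\<epsilon>/2)))\<bar> < \<epsilon>/2"
        using yn abs_Im_le_cmod le_less_trans by blast
      then have "\<bar>Im y - Im (f x) - \<epsilon>/2\<bar> < \<epsilon>/2" by (simp add: diff_diff_eq)
      then have "0 \<le> Im y" using fxP unfolding mem_Collect_eq abs_less_iff by linarith
      ultimately show "y \<in> ?B"
        by (simp add: dist_norm norm_minus_commute)
    qed
    then have "interior ?B \<noteq> {}"
      using \<epsilon>(1) interior_maximal[of "ball (f x + \<i> * of_real (\<epsilon>/2)) (\<epsilon>/2)" ?B]
      by (metis centre_in_ball empty_iff half_gt_zero open_ball subsetD)
    then have "aff_dim ?B = 2"
      by (simp add: aff_dim_nonempty_interior)
    then show ?thesis by (simp add: collinear_aff_dim)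
  qed
  ultimately have "connected (?B - {f x})"
    by (intro connected_convex_diff_countable) auto
  then have "connectedin (top_of_set S) (?B - {f x})"
    using BS by (auto simp: connectedin_subtopology)
  then have "connectedin (subtopology X U) (g ` (?B - {f x}))"
    using gcont connectedin_continuous_map_image by blast
  moreover have "g ` (?B - {f x}) = g ` ?B - {x}"
    using gf US(2) fgs BS by (auto simp: image_iff)
  ultimately have "connectedin X (g ` ?B - {x})"
    by (simp add: connectedin_subtopology)
  moreover have "x \<in> g ` ?B"
    using \<epsilon>(1) fxP gf US(2) by (intro image_eqI[of _ _ "f x"]) auto
  moreover have "g ` ?B \<subseteq> V"
    using \<epsilon>(2) gf by fastforce
  ultimately show ?thesis using that openW by blast
qed

section \<open>Vertex links of a surface and integration of closed dual one-forms\<close>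

context oriented_complex
begin

text \<open>A union \<open>C\<close> of link components and its complement would split a punctured
  neighbourhood of the vertex by unions of open stars. These are disjoint there, as positive
  coordinates at v, j and k put j and k into a common triangle with v; both are nonempty, as points
  near v on the edges show.\<close>

lemma surface_imp_link_connected:
  assumes surf: "surface_with_boundary (underlying_space K)" and v: "v \<in> vertices K"
  shows "link_connected v"
  unfolding link_connected_def
proof (intro allI impI)
  fix C assume C: "C \<subseteq> neighbours K v" and adj: "\<forall>j k. T v j k \<longrightarrow> (j \<in> C \<longleftrightarrow> k \<in> C)"
  let ?X = "underlying_space K"
  let ?v = "vertex_point v"
  have fin: "finite \<sigma>" if "\<sigma> \<in> K" for \<sigma>
    using complex that by (auto simp: abstract_simplicial_complex_def)
  obtain \<sigma> where \<sigma>: "\<sigma> \<in> K" "v \<in> \<sigma>" using v by (auto simp: vertices_def)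
  then have "?v \<in> open_star K v"
    using vertex_point_in_simplex[OF fin[OF \<sigma>(1)] \<sigma>(2)] by (auto simp: open_star_def vertex_point_def)
  then obtain W where W: "openin ?X W" "?v \<in> W" "W \<subseteq> open_star K v" "connectedin ?X (W - {?v})"
    using surface_punctured_neighbourhood[OF surf openin_open_star] by metis
  define A where "A = (\<lambda>D. W \<inter> (\<Union>j\<in>D. open_star K j))"
  have openA: "openin ?X (A D)" for D
    unfolding A_def by (intro openin_Int W openin_UN openin_open_star)
  have support: "j = v \<or> j \<in> neighbours K v" if "\<alpha> \<in> W" "\<alpha> j > 0" for \<alpha> j
  proof -
    have "\<alpha> v > 0" "\<alpha> \<in> topspace ?X"
      using that W(3) openin_subset[OF W(1)] by (auto simp: open_star_def)
    then obtain \<tau> where "\<tau> \<in> K" "{v, j} \<subseteq> \<tau>"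
      using open_star_Int_simplex[of \<alpha> K] \<open>\<alpha> j > 0\<close> by (metis empty_subsetI insert_subset)
    then show ?thesis
      using simplex_face[of \<tau> "{v, j}"] by (cases "j = v") (auto simp: neighbours_def edges_def)
  qed
  have cover: "W - {?v} \<subseteq> A C \<union> A (neighbours K v - C)"
  proof
    fix \<alpha> assume \<alpha>: "\<alpha> \<in> W - {?v}"
    then obtain \<tau> where \<tau>: "\<tau> \<in> K" "\<alpha> \<in> closed_simplex \<tau>" "\<alpha> v > 0"
      using W(3) by (auto simp: open_star_def)
    have "\<exists>j. j \<noteq> v \<and> \<alpha> j \<noteq> 0"
    proof (rule ccontr)
      assume "\<not> ?thesis"
      then have 0: "\<alpha> j = 0" if "j \<noteq> v" for j using that by blast
      moreover have "v \<in> \<tau>" using \<tau> by (auto simp: closed_simplex_def)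
      then have "sum \<alpha> \<tau> = \<alpha> v"
        using 0 fin[OF \<tau>(1)] by (subst sum.remove[of _ v]) (auto intro!: sum.neutral)
      then have "\<alpha> v = 1" using \<tau>(2) by (simp add: closed_simplex_def)
      ultimately have "\<alpha> = ?v" by (auto simp: vertex_point_def)
      then show False using \<alpha> by blast
    qed
    then obtain j where j: "j \<noteq> v" "\<alpha> j > 0"
      using \<tau>(2) by (force simp: closed_simplex_def less_le)
    then have "j \<in> neighbours K v" using support \<alpha> by blast
    moreover have "\<alpha> \<in> open_star K j" using \<tau> j by (auto simp: open_star_def)
    ultimately show "\<alpha> \<in> A C \<union> A (neighbours K v - C)" using \<alpha> by (auto simp: A_def)
  qed
  have disjoint: "A C \<inter> A (neighbours K v - C) = {}"
  proof (rule ccontr)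
    assume "\<not> ?thesis"
    then obtain \<alpha> j k where \<alpha>: "\<alpha> \<in> W" "j \<in> C" "k \<in> neighbours K v" "k \<notin> C" "\<alpha> j > 0" "\<alpha> k > 0" "\<alpha> v > 0"
      using W(3) by (auto simp: A_def open_star_def)
    moreover have "\<alpha> \<in> topspace ?X" using \<alpha>(1) openin_subset[OF W(1)] by blast
    ultimately obtain \<tau> where \<tau>: "\<tau> \<in> K" "{v, j, k} \<subseteq> \<tau>"
      using open_star_Int_simplex[of \<alpha> K] by (metis empty_subsetI insert_subset)
    have "v \<noteq> j" "v \<noteq> k" "j \<noteq> k"
      using \<alpha>(2-4) C neighbour_neq[of j v] neighbour_neq[of k v] by auto
    then have "{v, j, k} \<in> triangles K"
      using simplex_face[OF \<tau>] by (auto simp: triangles_def)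
    then have "T v j k \<or> T j v k" using T_swap by metis
    then have "T v j k \<or> T v k j" using T_rotate by metis
    then show False using adj \<alpha>(2,4) by metis
  qed
  have nonempty: "(W - {?v}) \<inter> A D \<noteq> {}" if j: "j \<in> D" "j \<in> neighbours K v" for j D
  proof -
    have jv: "j \<noteq> v" using neighbour_neq[OF j(2)] .
    have e: "{v, j} \<in> K" using j by (auto simp: neighbours_def edges_def)
    let ?g = "\<lambda>t w. (1 - t) * ?v w + t * vertex_point j w"
    have vp: "?v \<in> closed_simplex {v, j}" "vertex_point j \<in> closed_simplex {v, j}"
      by (auto intro: vertex_point_in_simplex)
    have "pathin ?X ?g"
      using pathin_segment[OF e vp] .
    then have "openin (top_of_set {0..1}) {t \<in> topspace (top_of_set {0..1}). ?g t \<in> W}"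
      unfolding pathin_def using W(1) openin_continuous_map_preimage by blast
    moreover have "0 \<in> {t \<in> topspace (top_of_set {0..1}). ?g t \<in> W}"
      using W(2) by simp
    ultimately obtain \<epsilon> where \<epsilon>: "\<epsilon> > 0" "ball 0 \<epsilon> \<inter> {0..1} \<subseteq> {t \<in> topspace (top_of_set {0..1::real}). ?g t \<in> W}"
      unfolding openin_contains_ball by meson
    define t where "t = min (\<epsilon> / 2) 1"
    have t: "t > 0" "t \<le> 1" "?g t \<in> W"
      using \<epsilon> by (auto simp: t_def subset_iff)
    have "?g t j = t" using jv by (simp add: vertex_point_def)
    then have "?g t \<noteq> ?v" "?g t \<in> open_star K j"
      using t jv W(3) by (auto simp: vertex_point_def open_star_def fun_eq_iff)
    then show ?thesis using t j by (auto simp: A_def)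
  qed
  show "C = {} \<or> C = neighbours K v"
  proof (rule ccontr)
    assume "\<not> ?thesis"
    then obtain j k where "j \<in> C" "k \<in> neighbours K v - C" using C by blast
    then have "A C \<inter> (W - {?v}) \<noteq> {}" "A (neighbours K v - C) \<inter> (W - {?v}) \<noteq> {}"
      using nonempty[of j C] nonempty[of k "neighbours K v - C"] C by blast+
    moreover have "A C \<inter> A (neighbours K v - C) \<inter> (W - {?v}) = {}" using disjoint by simp
    ultimately show False
      using W(4) openA[of C] openA[of "neighbours K v - C"] cover unfolding connectedin by blast
  qed
qed

lemma ex_dual_potential:
  fixes \<omega> :: "'v \<Rightarrow> 'v \<Rightarrow> 'b::ab_group_add"
  assumes surf: "surface_with_boundary (underlying_space K)"
    and sc: "simply_connected_space (underlying_space K)"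
    and anti: "\<And>i j. {i, j} \<in> interior_edges K \<Longrightarrow> \<omega> j i = - \<omega> i j"
    and closed: "\<And>i. i \<in> interior_vertices K \<Longrightarrow> (\<Sum>j\<in>neighbours K i. \<omega> i j) = 0"
  obtains f where "\<And>i j. {i, j} \<in> interior_edges K \<Longrightarrow> dual_diff T f i j = \<omega> i j"
proof -
  have "\<exists>g. \<forall>j k l. T v j k \<and> T v l j \<longrightarrow> g {v, j, k} - g {v, l, j} = \<omega> v j" for v
  proof (cases "v \<in> vertices K")
    case True
    then show ?thesis
      by (intro ex_local_potential surface_imp_link_connected[OF surf] closed)
  next
    case False
    have "\<not> T v j k" for j k
      using T_triangle[of v j k] triangles_subset False by (auto simp: vertices_def)
    then show ?thesis by blast
  qed
  then obtain g where g: "\<And>v j k l. \<lbrakk>T v j k; T v l j\<rbrakk> \<Longrightarrow> g v {v, j, k} - g v {v, l, j} = \<omega> v j"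
    by metis
  have g_dual: "dual_diff T (g v) v j = \<omega> v j" if "{v, j} \<in> interior_edges K" for v j
    using that g dual_diff_eq by (metis interior_edge_iff')
  \<comment> \<open>The choice of triangle is immaterial: distinct vertices share at most two
    triangles, one on either side of their edge, and across it \<open>g v\<close> and
    \<open>g w\<close> have the same difference by \<open>anti\<close>.\<close>
  define c where "c = (\<lambda>v w. let t = SOME t. t \<in> triangles K \<and> v \<in> t \<and> w \<in> t in g v t - g w t)"
  have c: "c v w = g v t - g w t" if t: "t \<in> triangles K" "v \<in> t" "w \<in> t" for v w t
  proof -
    have "g v t - g w t = g v t' - g w t'"
      if vw: "v \<noteq> w" and t': "t' \<in> triangles K" "v \<in> t'" "w \<in> t'" and "t \<noteq> t'" for t'
    proof -
      obtain k where k: "t = {v, w, k}" "T v w k \<or> T w v k"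
        using triangle_through_edge[OF t(1) _ vw] t(2,3) by auto
      obtain l where l: "t' = {v, w, l}" "T v w l \<or> T w v l"
        using triangle_through_edge[OF t'(1) _ vw] t'(2,3) by auto
      have sides: "T v w k \<and> T w v l \<or> T w v k \<and> T v w l"
        using k l \<open>t \<noteq> t'\<close> T_unique by metis
      then have int: "{v, w} \<in> interior_edges K"
        unfolding interior_edge_iff by metis
      then have int': "{w, v} \<in> interior_edges K"
        by (simp add: insert_commute)
      have eq: "dual_diff T (g w) v w = dual_diff T (g v) v w"
        using g_dual[OF int] g_dual[OF int'] anti[OF int] dual_diff_commute[of "g w" w v] by simp
      from sides show ?thesis
      proof
        assume "T v w k \<and> T w v l"
        then have "left_face T v w = t" "right_face T v w = t'"
          using k(1) l(1) left_face_eq[of v w k] right_face_eq[of w v l] by (simp_all add: insert_commute)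
        then show ?thesis using eq by (simp add: dual_diff_def algebra_simps)
      next
        assume "T w v k \<and> T v w l"
        then have "left_face T v w = t'" "right_face T v w = t"
          using k(1) l(1) left_face_eq[of v w l] right_face_eq[of w v k] by (simp_all add: insert_commute)
        then show ?thesis using eq by (simp add: dual_diff_def algebra_simps)
      qed
    qed
    note indep = this
    define t' where "t' = (SOME t. t \<in> triangles K \<and> v \<in> t \<and> w \<in> t)"
    have t': "t' \<in> triangles K \<and> v \<in> t' \<and> w \<in> t'"
      unfolding t'_def by (rule someI[of _ t]) (use t in simp)
    have "g v t - g w t = g v t' - g w t'"
      using indep[of t'] t' by (cases "v = w"; cases "t = t'") simp_all
    then show ?thesis by (simp add: c_def t'_def Let_def)
  qed
  \<comment> \<open>Members of the cover with a common point have their vertices in one triangle,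
    and on a fixed triangle the cocycle identity is a cancellation.\<close>
  have in_triangle: "\<exists>t\<in>triangles K. \<forall>v. 0 < \<alpha> v \<longrightarrow> v \<in> t" if "\<alpha> \<in> open_star K u" for \<alpha> u
  proof -
    have "\<alpha> \<in> topspace (underlying_space K)"
      using openin_subset[OF openin_open_star] that by (rule subsetD)
    then obtain \<sigma> where \<sigma>: "\<sigma> \<in> K" "\<And>v. 0 < \<alpha> v \<Longrightarrow> v \<in> \<sigma>"
      using open_star_Int_simplex by metis
    obtain t where "t \<in> triangles K" "\<sigma> \<subseteq> t" using pure[OF \<sigma>(1)] by metis
    with \<sigma>(2) show ?thesis by (intro bexI[of _ t]) auto
  qed
  interpret cech_cocycle "underlying_space K" "open_star K" c
  proof
    show "c u v + c v w = c u w"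
      if \<alpha>: "\<alpha> \<in> open_star K u" "\<alpha> \<in> open_star K v" "\<alpha> \<in> open_star K w" for \<alpha> u v w
    proof -
      obtain t where "t \<in> triangles K" "u \<in> t" "v \<in> t" "w \<in> t"
        using in_triangle[OF \<alpha>(1)] \<alpha> by (auto simp: open_star_def)
      then show ?thesis by (simp add: c)
    qed
  qed (use openin_open_star open_star_cover[OF complex] in auto)
  obtain h where h: "\<And>v w. open_star K v \<inter> open_star K w \<noteq> {} \<Longrightarrow> c v w = h v - h w"
    using simply_connected_imp_coboundary[OF sc path_connectedin_open_star[OF complex]] by blast
  have gh: "g v t - h v = g w t - h w" if t: "t \<in> triangles K" "v \<in> t" "w \<in> t" for t v w
  proof -
    \<comment> \<open>The barycentre lies in the open stars of all three vertices, so the coboundary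
      formula applies to every pair of vertices of \<open>t\<close>.\<close>
    define \<alpha> where "\<alpha> = (\<lambda>u. if u \<in> t then 1 / 3 else 0 :: real)"
    have "\<alpha> \<in> closed_simplex t" "t \<in> K"
      using t by (auto simp: \<alpha>_def closed_simplex_def triangles_def)
    then have "\<alpha> \<in> open_star K v \<inter> open_star K w"
      using t by (auto simp: open_star_def \<alpha>_def)
    then have "c v w = h v - h w" using h by blast
    then show ?thesis using c[OF t] by (simp add: algebra_simps)
  qed
  define f where "f = (\<lambda>t. let v = SOME v. v \<in> t in g v t - h v)"
  have f: "f t = g v t - h v" if "t \<in> triangles K" "v \<in> t" for t v
    using gh[OF that(1) _ that(2)] someI[of "\<lambda>v. v \<in> t", OF that(2)] by (auto simp: f_def Let_def)
  have "dual_diff T f i j = \<omega> i j" if int: "{i, j} \<in> interior_edges K" for i j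
  proof -
    obtain k l where kl: "T i j k" "T i l j" using int unfolding interior_edge_iff' by blast
    have "f {i, j, k} = g i {i, j, k} - h i" "f {i, l, j} = g i {i, l, j} - h i"
      using kl T_triangle by (auto intro!: f)
    then have "dual_diff T f i j = (g i {i, j, k} - h i) - (g i {i, l, j} - h i)"
      using dual_diff_eq[OF kl, of f] by simp
    then show ?thesis using g[OF kl] by simp
  qed
  then show ?thesis using that by blast
qed

end

section \<open>The Weierstrass representation\<close>

theorem theorem6p3:
  fixes K :: "'v set set" and T :: "'v \<Rightarrow> 'v \<Rightarrow> 'v \<Rightarrow> bool" and z :: "'v \<Rightarrow> complex"
  assumes "triangular_mesh K T"
    and "simply_connected_space (underlying_space K)"
    and "realization K z"
  shows "(\<forall>q. holomorphic_quadratic_differential K z q \<longrightarrow>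
            (\<exists>f. weierstrass_representation K T z q f) \<and>
            (\<forall>f. weierstrass_representation K T z q f \<longrightarrow>
               discrete_minimal_surface K T (\<lambda>v. inverse_stereographic (z v)) f)) \<and>
         (\<forall>n f. (\<forall>v\<in>vertices K. n v = inverse_stereographic (z v)) \<and>
            discrete_minimal_surface K T n f \<longrightarrow>
            (\<exists>q. holomorphic_quadratic_differential K z q \<and>
                 weierstrass_representation K T z q f))"
proof -
  have surf: "surface_with_boundary (underlying_space K)"
    and "oriented_complex K T"
    using assms(1) by (auto simp: triangular_mesh_def oriented_complex_def)
  interpret oriented_complex K T by fact
  let ?n = "\<lambda>v. inverse_stereographic (z v)"
  have neq: "z i \<noteq> z j" if "{i, j} \<in> interior_edges K" for i j
    using that realization_edge(1)[OF assms(3)] interior_edge_iff by metis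
  have weierstrass_iff: "weierstrass_representation K T z q f \<longleftrightarrow>
      (\<forall>i j. {i, j} \<in> interior_edges K \<longrightarrow> dual_diff T f i j = Im (q {i, j}) *\<^sub>R null_curve (z i) (z j))"
    if "\<And>e. e \<in> interior_edges K \<Longrightarrow> Re (q e) = 0" for q f
    unfolding weierstrass_representation_def using Re_vec_eq_null_curve that by metis
  have int: "{i, j} \<in> interior_edges K" if "i \<in> interior_vertices K" "j \<in> neighbours K i" for i j
    using that interior_vertex_iff by metis
  have neq': "z j \<noteq> z i" if "i \<in> interior_vertices K" "j \<in> neighbours K i" for i j
    using neq[OF int[OF that]] by simp
  have holomorphic_iff: "holomorphic_quadratic_differential K z q \<longleftrightarrow>
      (\<forall>i\<in>interior_vertices K. (\<Sum>j\<in>neighbours K i. Im (q {i, j}) *\<^sub>R null_curve (z i) (z j)) = 0)"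
    if "\<And>e. e \<in> interior_edges K \<Longrightarrow> Re (q e) = 0" for q
  proof -
    have "((\<Sum>j\<in>neighbours K i. q {i, j}) = 0 \<and> (\<Sum>j\<in>neighbours K i. q {i, j} / (z j - z i)) = 0) =
        ((\<Sum>j\<in>neighbours K i. Im (q {i, j}) *\<^sub>R null_curve (z i) (z j)) = 0)"
      if i: "i \<in> interior_vertices K" for i
      by (rule holomorphic_at_vertex_iff)
        (use neq'[OF i] int[OF i] \<open>\<And>e. e \<in> interior_edges K \<Longrightarrow> Re (q e) = 0\<close> in auto)
    with that show ?thesis
      by (simp add: holomorphic_quadratic_differential_def)
  qed
  show ?thesis
  proof (intro conjI allI impI)
    fix q assume q: "holomorphic_quadratic_differential K z q"
    then have Re: "\<And>e. e \<in> interior_edges K \<Longrightarrow> Re (q e) = 0"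
      by (simp add: holomorphic_quadratic_differential_def)
    show "\<exists>f. weierstrass_representation K T z q f"
    proof (rule ex_dual_potential[OF surf assms(2)])
      show "Im (q {j, i}) *\<^sub>R null_curve (z j) (z i) = - (Im (q {i, j}) *\<^sub>R null_curve (z i) (z j))" for i j
        using null_curve_commute[of "z j" "z i"] by (simp add: insert_commute)
      show "(\<Sum>j\<in>neighbours K i. Im (q {i, j}) *\<^sub>R null_curve (z i) (z j)) = 0"
        if "i \<in> interior_vertices K" for i
        using q that holomorphic_iff[of q, OF Re] by simp
      show ?thesis if "\<And>i j. {i, j} \<in> interior_edges K \<Longrightarrow>
          dual_diff T f i j = Im (q {i, j}) *\<^sub>R null_curve (z i) (z j)" for f
        using that weierstrass_iff[of q f, OF Re] by (intro exI[of _ f]) simp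
    qed
    fix f assume f: "weierstrass_representation K T z q f"
    have "cross3 (?n j - ?n i) (dual_diff T f i j) = 0" if ij: "{i, j} \<in> interior_edges K" for i j
      unfolding cross3_stereographic_eq_0_iff[OF neq[OF ij]]
      using f weierstrass_iff[of q f, OF Re] ij by metis
    then show "discrete_minimal_surface K T ?n f"
      using spherical_realization_inverse_stereographic[OF assms(3)]
      by (simp add: discrete_minimal_surface_def)
  next
    fix n f
    assume nf: "(\<forall>v\<in>vertices K. n v = ?n v) \<and> discrete_minimal_surface K T n f"
    \<comment> \<open>Both the dual difference and the null curve change sign when the edge is
      reversed, so one real factor serves both orientations and q is well defined on unoriented
      edges.\<close>
    have "\<exists>r. \<forall>i j. e = {i, j} \<longrightarrow> dual_diff T f i j = r *\<^sub>R null_curve (z i) (z j)"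
      if e: "e \<in> interior_edges K" for e
    proof -
      obtain i j where ij: "e = {i, j}"
        using e by (auto simp: interior_edges_def edges_def card_2_iff)
      have "e \<in> K"
        using e by (simp add: interior_edges_def edges_def)
      then have "i \<in> vertices K" "j \<in> vertices K"
        using ij by (auto simp: vertices_def)
      moreover have "cross3 (n j - n i) (dual_diff T f i j) = 0"
        using nf e ij by (simp add: discrete_minimal_surface_def)
      ultimately have "cross3 (?n j - ?n i) (dual_diff T f i j) = 0"
        using nf by simp
      moreover have "z i \<noteq> z j" using neq e ij by simp
      ultimately obtain r where r: "dual_diff T f i j = r *\<^sub>R null_curve (z i) (z j)"
        using cross3_stereographic_eq_0_iff by metis
      moreover have "dual_diff T f j i = r *\<^sub>R null_curve (z j) (z i)"
        using r dual_diff_commute[of f j i] null_curve_commute[of "z j" "z i"] by simp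
      ultimately show ?thesis
        unfolding ij doubleton_eq_iff by (intro exI[of _ r]) auto
    qed
    then obtain \<rho> where \<rho>: "\<And>e i j. \<lbrakk>e \<in> interior_edges K; e = {i, j}\<rbrakk> \<Longrightarrow>
        dual_diff T f i j = \<rho> e *\<^sub>R null_curve (z i) (z j)"
      by metis
    define q where "q = (\<lambda>e. \<i> * complex_of_real (\<rho> e))"
    have q: "Re (q e) = 0" "Im (q e) = \<rho> e" for e
      by (simp_all add: q_def)
    have dual: "dual_diff T f i j = Im (q {i, j}) *\<^sub>R null_curve (z i) (z j)"
      if "{i, j} \<in> interior_edges K" for i j
      using \<rho>[OF that] q by simp
    \<comment> \<open>Holomorphicity comes for free here: the weighted sum is a sum of differences
      of f around the vertex, which cancels.\<close>
    have "(\<Sum>j\<in>neighbours K i. Im (q {i, j}) *\<^sub>R null_curve (z i) (z j)) = 0"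
      if i: "i \<in> interior_vertices K" for i
    proof -
      have "(\<Sum>j\<in>neighbours K i. Im (q {i, j}) *\<^sub>R null_curve (z i) (z j)) =
          (\<Sum>j\<in>neighbours K i. dual_diff T f i j)"
        using dual[OF int[OF i]] by (intro sum.cong) simp_all
      then show ?thesis using sum_dual_diff_eq_0[OF i] by simp
    qed
    then have "holomorphic_quadratic_differential K z q"
      by (simp add: holomorphic_iff q(1))
    moreover have "weierstrass_representation K T z q f"
      using dual by (simp add: weierstrass_iff q(1))
    ultimately show "\<exists>q. holomorphic_quadratic_differential K z q \<and> weierstrass_representation K T z q f"
      by metis
  qed
qed

end
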